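(* Let $G$ and $N$ be networks that intersect in exactly one vertex $v$. Let $w'\ne v$ be a vertex of $G$ and $w''\ne v$ a vertex of $N$. Let $U=G\cup N$, let $W$ be the network obtained from $U$ by identifying $w'$ and $w''$, and let $w$ be the image of $w'$ and $w''$ in $W$. Suppose $\{v,w'\}$ is amicable in $G$ and $\{v,w''\}$ is amicable in $N$. Then: (a) $\{v,w'\}$ and $\{v,w''\}$ are amicable in $U$; (b) $\{v,w\}$ is amicable in $W$; (c) $\{w',w''\}$ is very amicable in $U$.
   Context: A network is a finite connected loopless multigraph, possibly with multiple edges. Polynomials attached to a loopless multigraph. Let $G$ have $m$ edges and $n$ vertices, and put $d=m-n+1$. Let $R_G(q)$ be the probability that deleting each edge independently with probability $q$ leaves a connected spanning subgraph. Put $H_G(q)=(1-q)^{1-n}R_G(q)$ (a polynomial) and $J_G(u)=(u-1)^dH_G\big(\frac{-1-u}{1-u}\big)$. If $G$ is disconnected then $R_G\equiv0$, so $J_G\equiv0$. Write $J_G(u)=J^G_0(u^2)+uJ^G_1(u^2)$ with $J^G_0,J^G_1\in\mathbb{R}[x]$. Relation $\prec$: for $A,B\in\mathbb{R}[x]$ with only real zeros, with zeros $\xi_1\le\cdots\le\xi_a$ of $A$ and $\theta_1\le\cdots\le\theta_b$ of $B$, $A\prec B$ means one of the following: - $\deg B=\deg A+1$ and $\theta_1\le\xi_1\le\theta_2\le\cdots\le\xi_a\le\theta_{a+1}$; - $\deg A=\deg B$ and $\xi_1\le\theta_1\le\cdots\le\xi_a\le\theta_a$. By convention $A\prec0$ and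 $0\prec A$ for every $A$ with only real zeros. A polynomial is standard if it is identically $0$ or has positive leading coefficient. It has only nonpositive zeros if it is identically $0$ or all its zeros are real and $\le0$. An interpolatory 1-cube is a pair $(A,B)$ of standard polynomials with only nonpositive zeros such that $A\prec B$. A quadruple $(A,B,P,Q)$ of polynomials in $\mathbb{R}[x]$ is an interpolatory square if, for all $\lambda,\rho>0$, both $(\lambda A+\rho B,\lambda P+\rho Q)$ and $(\lambda B+\rho xA,\lambda Q+\rho xP)$ are interpolatory 1-cubes. Amicability. For a network $G$ and distinct vertices $v,w$: - $G^-$ is obtained from $G$ by deleting all edges between $v$ and $w$; - $G^\bullet$ is obtained by identifying $v$ and $w$ and removing the loops created; - $J^-_i:=J^{G^-}_i$ and $J^\bullet_i:=J^{G^\bullet}_i$. The pair $\{v,w\}$ is amicable in $G$ if $(J^-_1+J^\bullet_1,\ J^-_0+J^\bullet_0,\ J^-_0,\ xJ^-_1)$ is an interpolatory square. It is very amicable in $G$ if $(J^\bullet_1,\ J^\bullet_0,\ J^-_0,\ xJ^-_1)$ is an interpolatory square. *)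

theory Defs
  imports Complex_Main "HOL-Computational_Algebra.Polynomial"
begin

section \<open>Multigraphs (networks)\<close>

text \<open>A multigraph has a vertex set, a set of edge labels, and an endpoint map.
  Parallel edges are distinct labels with the same endpoints; orientation of
  the endpoint pair is irrelevant.\<close>

record ('a, 'e) mgraph =
  verts :: "'a set"
  edges :: "'e set"
  ends  :: "'e \<Rightarrow> 'a \<times> 'a"

definition adj_rel :: "('e \<Rightarrow> 'a \<times> 'a) \<Rightarrow> 'e set \<Rightarrow> ('a \<times> 'a) set" where
  "adj_rel f S = {(a, b). \<exists>e\<in>S. f e = (a, b) \<or> f e = (b, a)}"

text \<open>The spanning subgraph with vertex set V and edge set S is connected.\<close>
definition conn_spanning :: "('a, 'e) mgraph \<Rightarrow> 'e set \<Rightarrow> bool" where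
  "conn_spanning G S \<longleftrightarrow> (\<forall>x\<in>verts G. \<forall>y\<in>verts G. (x, y) \<in> (adj_rel (ends G) S)\<^sup>*)"

definition wf_mgraph :: "('a, 'e) mgraph \<Rightarrow> bool" where
  "wf_mgraph G \<longleftrightarrow> finite (verts G) \<and> finite (edges G) \<and>
     (\<forall>e\<in>edges G. fst (ends G e) \<in> verts G \<and> snd (ends G e) \<in> verts G
                    \<and> fst (ends G e) \<noteq> snd (ends G e))"

text \<open>A network: finite, connected, loopless multigraph (nonempty).\<close>
definition network :: "('a, 'e) mgraph \<Rightarrow> bool" where
  "network G \<longleftrightarrow> wf_mgraph G \<and> verts G \<noteq> {} \<and> conn_spanning G (edges G)"

text \<open>Delete all edges between v and w.\<close>
definition del_between :: "('a, 'e) mgraph \<Rightarrow> 'a \<Rightarrow> 'a \<Rightarrow> ('a, 'e) mgraph" where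
  "del_between G v w = G\<lparr> edges := {e \<in> edges G. ends G e \<noteq> (v, w) \<and> ends G e \<noteq> (w, v)} \<rparr>"

text \<open>Identify w with v (the merged vertex is called v) and remove the loops created.\<close>
definition identify :: "('a, 'e) mgraph \<Rightarrow> 'a \<Rightarrow> 'a \<Rightarrow> ('a, 'e) mgraph" where
  "identify G v w =
     (let f = (\<lambda>x. if x = w then v else x) in
      \<lparr> verts = f ` verts G,
        edges = {e \<in> edges G. f (fst (ends G e)) \<noteq> f (snd (ends G e))},
        ends = (\<lambda>e. map_prod f f (ends G e)) \<rparr>)"

text \<open>Union of two multigraphs with disjoint edge label sets.\<close>
definition mg_union :: "('a, 'e) mgraph \<Rightarrow> ('a, 'e) mgraph \<Rightarrow> ('a, 'e) mgraph" where
  "mg_union G N =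
     \<lparr> verts = verts G \<union> verts N,
       edges = edges G \<union> edges N,
       ends = (\<lambda>e. if e \<in> edges G then ends G e else ends N e) \<rparr>"

section \<open>The polynomials R, H, J, J0, J1\<close>

definition R_poly :: "('a, 'e) mgraph \<Rightarrow> real poly" where
  "R_poly G = (\<Sum>S\<in>{S. S \<subseteq> edges G \<and> conn_spanning G S}.
       [:1, -1:] ^ card S * [:0, 1:] ^ (card (edges G) - card S))"

definition H_poly :: "('a, 'e) mgraph \<Rightarrow> real poly" where
  "H_poly G = (THE p. \<forall>q. q \<noteq> 1 \<longrightarrow>
      poly p q = (1 - q) powi (1 - int (card (verts G))) * poly (R_poly G) q)"

definition J_poly :: "('a, 'e) mgraph \<Rightarrow> real poly" where
  "J_poly G = (let d = int (card (edges G)) - int (card (verts G)) + 1 in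
     THE p. \<forall>u. u \<noteq> 1 \<longrightarrow>
      poly p u = (u - 1) powi d * poly (H_poly G) ((-1 - u) / (1 - u)))"

text \<open>Even and odd parts: p(u) = p0(u^2) + u * p1(u^2).\<close>
definition even_part :: "real poly \<Rightarrow> real poly" where
  "even_part p = Poly (map (\<lambda>i. coeff p (2 * i)) [0..<Suc (degree p)])"

definition odd_part :: "real poly \<Rightarrow> real poly" where
  "odd_part p = Poly (map (\<lambda>i. coeff p (2 * i + 1)) [0..<Suc (degree p)])"

definition J0 :: "('a, 'e) mgraph \<Rightarrow> real poly" where
  "J0 G = even_part (J_poly G)"

definition J1 :: "('a, 'e) mgraph \<Rightarrow> real poly" where
  "J1 G = odd_part (J_poly G)"

section \<open>Interlacing and interpolatory squares\<close>

definition only_real_zeros :: "real poly \<Rightarrow> bool" where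
  "only_real_zeros A \<longleftrightarrow> A = 0 \<or>
     (\<forall>z. poly (map_poly complex_of_real A) z = 0 \<longrightarrow> z \<in> \<real>)"

definition interlaces :: "real poly \<Rightarrow> real poly \<Rightarrow> bool" (infix "\<prec>" 50) where
  "A \<prec> B \<longleftrightarrow> only_real_zeros A \<and> only_real_zeros B \<and>
     (A = 0 \<or> B = 0 \<or>
      (let \<xi> = sorted_list_of_multiset (proots A);
           \<theta> = sorted_list_of_multiset (proots B);
           a = length \<xi> in
        (degree B = degree A + 1 \<and>
           (\<forall>i<a. \<theta> ! i \<le> \<xi> ! i \<and> \<xi> ! i \<le> \<theta> ! (i + 1))) \<or>
        (degree A = degree B \<and>
           (\<forall>i<a. \<xi> ! i \<le> \<theta> ! i \<and> (i + 1 < a \<longrightarrow> \<theta> ! i \<le> \<xi> ! (i + 1))))))"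

definition standard :: "real poly \<Rightarrow> bool" where
  "standard A \<longleftrightarrow> A = 0 \<or> lead_coeff A > 0"

definition only_nonpos_zeros :: "real poly \<Rightarrow> bool" where
  "only_nonpos_zeros A \<longleftrightarrow> A = 0 \<or>
     (only_real_zeros A \<and> (\<forall>x. poly A x = 0 \<longrightarrow> x \<le> 0))"

definition interp_cube1 :: "real poly \<Rightarrow> real poly \<Rightarrow> bool" where
  "interp_cube1 A B \<longleftrightarrow> standard A \<and> standard B \<and>
     only_nonpos_zeros A \<and> only_nonpos_zeros B \<and> A \<prec> B"

definition interp_square :: "real poly \<Rightarrow> real poly \<Rightarrow> real poly \<Rightarrow> real poly \<Rightarrow> bool" where
  "interp_square A B P Q \<longleftrightarrow>
     (\<forall>lam rho. lam > 0 \<longrightarrow> rho > 0 \<longrightarrow>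
        interp_cube1 (smult lam A + smult rho B) (smult lam P + smult rho Q) \<and>
        interp_cube1 (smult lam B + smult rho ([:0, 1:] * A))
                     (smult lam Q + smult rho ([:0, 1:] * P)))"

section \<open>Amicability\<close>

definition amicable :: "('a, 'e) mgraph \<Rightarrow> 'a \<Rightarrow> 'a \<Rightarrow> bool" where
  "amicable G v w \<longleftrightarrow> v \<in> verts G \<and> w \<in> verts G \<and> v \<noteq> w \<and>
     (let Gm = del_between G v w; Gb = identify G v w in
      interp_square (J1 Gm + J1 Gb) (J0 Gm + J0 Gb) (J0 Gm) ([:0, 1:] * J1 Gm))"

definition very_amicable :: "('a, 'e) mgraph \<Rightarrow> 'a \<Rightarrow> 'a \<Rightarrow> bool" where
  "very_amicable G v w \<longleftrightarrow> v \<in> verts G \<and> w \<in> verts G \<and> v \<noteq> w \<and>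
     (let Gm = del_between G v w; Gb = identify G v w in
      interp_square (J1 Gb) (J0 Gb) (J0 Gm) ([:0, 1:] * J1 Gm))"

end

theory Submission
  imports Defs "HOL-Computational_Algebra.Fundamental_Theorem_Algebra"
begin

text \<open>Fix \<open>x\<close> in the open upper half plane and let \<open>C = {s + t x | s, t \<ge> 0}\<close>. For polynomials with
  nonnegative coefficients and only real zeros, \<open>(A, B)\<close> is an interpolatory 1-cube iff
  \<open>B(x) cnj (A(x)) \<in> C\<close> for all \<open>x\<close>: the argument of \<open>B/A\<close> is a sum of angles under which the zeros
  are seen from \<open>x\<close>.

  Write \<open>K = J\<^sup>- + J\<^sup>\<bullet>\<close> and \<open>J = J\<^sup>-\<close> as polynomials in \<open>u\<close>, where \<open>x = u\<^sup>2\<close>. Amicability says that for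
  \<open>\<mu> = \<lambda> + \<rho> u\<close> the odd (even) parts of \<open>\<mu> K\<close> and of \<open>\<mu> u J\<close> form 1-cubes. At a fixed \<open>x\<close> this extends from
  \<open>\<lambda>, \<rho> > 0\<close> to all complex \<open>\<lambda>, \<rho>\<close> with \<open>\<lambda> cnj \<rho> \<in> C\<close>, and in this form the relation between \<open>K\<close> and \<open>u J\<close> is
  symmetric, additive in each argument and stable under multiplication by a Hurwitz polynomial.
  Hence, if \<open>(K, J)\<close> and \<open>(K', J')\<close> are such pairs, so are \<open>(K K' + J J', K J' + J K')\<close> and \<open>(K J' + J K', J J')\<close>.

  Counting connected spanning subgraphs shows that gluing two networks along \<open>v\<close> and \<open>w\<close> produces the
  first of these pairs, that identifying \<open>w'\<close> with \<open>w''\<close> in \<open>U\<close> produces the second one, and that the pairs of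
  (a) are the special case \<open>(K', J') = (J\<^sub>N, 0)\<close> of the first.\<close>

section \<open>Real polynomials on the upper half plane\<close>


text \<open>Why the sum \<open>J\<^sup>- + J\<^sup>\<bullet>\<close> is the right partner of
  \<open>J\<^sup>-\<close>: when two networks are glued at two vertices, a subgraph is connected iff
  one side is connected and the other is connected once its two terminals are identified. If both
  sides are connected the two alternatives overlap, and removing the overlap leaves a term
  \<open>2 J J'\<close>; it disappears if each identified polynomial is increased by
  \<open>J\<close>. With a formal \<epsilon>, \<epsilon>^2 = 1, gluing then multiplies the elements
  \<open>K + \<epsilon> J\<close>, and identifying the terminals multiplies \<open>K - J\<close>.
  The cone condition is linear, but a 1-cube also demands real zeros, and a sum such as
  \<open>K K' + J J'\<close> might acquire zeros off the real axis by cancellation. The square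
  relation itself forbids this: both summands are related to \<open>K J'\<close>, whose
  corresponding value is nonzero unless one summand is the zero polynomial. Zero polynomials occur
  naturally, since deleting the edges between two vertices may disconnect a network, and then
  \<open>J\<^sup>- = 0\<close>.\<close>

definition ceval :: "real poly \<Rightarrow> complex \<Rightarrow> complex" where
  "ceval A x = poly (map_poly complex_of_real A) x"

lemma ceval_0 [simp]: "ceval 0 x = 0"
  by (simp add: ceval_def)

lemma ceval_1 [simp]: "ceval 1 x = 1"
  by (simp add: ceval_def)

lemma ceval_pCons [simp]: "ceval (pCons a A) x = of_real a + x * ceval A x"
  by (simp add: ceval_def map_poly_pCons)

lemma ceval_add [simp]: "ceval (A + B) x = ceval A x + ceval B x"
proof -
  have "map_poly complex_of_real (A + B) = map_poly complex_of_real A + map_poly complex_of_real B"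
    by (rule poly_eqI) (simp add: coeff_map_poly)
  then show ?thesis
    by (simp add: ceval_def)
qed

lemma ceval_smult [simp]: "ceval (smult a A) x = of_real a * ceval A x"
  by (induction A) (simp_all add: algebra_simps)

lemma ceval_mult [simp]: "ceval (A * B) x = ceval A x * ceval B x"
  by (induction A) (simp_all add: algebra_simps)

lemma ceval_prod_mset: "ceval (prod_mset M) x = (\<Prod>p\<in>#M. ceval p x)"
  by (induction M) simp_all

lemma ceval_of_real: "ceval A (of_real r) = of_real (poly A r)"
  by (induction A) simp_all

lemma ceval_cnj: "ceval A (cnj x) = cnj (ceval A x)"
  by (induction A) simp_all

section \<open>Nonnegative coefficients\<close>

definition nonneg_coeffs :: "real poly \<Rightarrow> bool" where
  "nonneg_coeffs A \<longleftrightarrow> (\<forall>i. coeff A i \<ge> 0)"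

lemma nonneg_coeffs_0 [simp]: "nonneg_coeffs 0"
  and nonneg_coeffs_1 [simp]: "nonneg_coeffs 1"
  by (simp_all add: nonneg_coeffs_def)

lemma nonneg_coeffs_pCons [simp]: "nonneg_coeffs (pCons a A) \<longleftrightarrow> a \<ge> 0 \<and> nonneg_coeffs A"
  unfolding nonneg_coeffs_def by (metis coeff_pCons_0 coeff_pCons_Suc nat.exhaust)

lemma nonneg_coeffs_add: "nonneg_coeffs A \<Longrightarrow> nonneg_coeffs B \<Longrightarrow> nonneg_coeffs (A + B)"
  by (simp add: nonneg_coeffs_def)

lemma nonneg_coeffs_smult: "a \<ge> 0 \<Longrightarrow> nonneg_coeffs A \<Longrightarrow> nonneg_coeffs (smult a A)"
  by (simp add: nonneg_coeffs_def)

lemma nonneg_coeffs_mult: "nonneg_coeffs A \<Longrightarrow> nonneg_coeffs B \<Longrightarrow> nonneg_coeffs (A * B)"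
  by (auto simp: nonneg_coeffs_def coeff_mult intro!: sum_nonneg)

lemma nonneg_coeffs_prod_mset: "(\<And>p. p \<in># M \<Longrightarrow> nonneg_coeffs p) \<Longrightarrow> nonneg_coeffs (prod_mset M)"
  by (induction M) (auto intro: nonneg_coeffs_mult)

lemma nonneg_coeffs_add_eq_0:
  "nonneg_coeffs A \<Longrightarrow> nonneg_coeffs B \<Longrightarrow> A + B = 0 \<longleftrightarrow> A = 0 \<and> B = 0"
  by (auto simp: nonneg_coeffs_def poly_eq_iff add_nonneg_eq_0_iff)

lemma nonneg_coeffs_lead_coeff: "nonneg_coeffs A \<Longrightarrow> A \<noteq> 0 \<Longrightarrow> lead_coeff A > 0"
  by (metis leading_coeff_neq_0 nonneg_coeffs_def order_le_less)

lemma nonneg_coeffs_poly_pos: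
  assumes "nonneg_coeffs A" "A \<noteq> 0" "r > 0"
  shows "poly A r > 0"
proof -
  have "0 < lead_coeff A * r ^ degree A"
    using assms nonneg_coeffs_lead_coeff by simp
  also have "\<dots> \<le> (\<Sum>i\<le>degree A. coeff A i * r ^ i)"
    using assms by (intro member_le_sum) (auto simp: nonneg_coeffs_def)
  finally show ?thesis
    by (simp add: poly_altdef)
qed

text \<open>The limits \<open>t \<rightarrow> 0\<close> and
  \<open>t \<rightarrow> \<infinity>\<close> at once; this passes from all positive combinations of
  two polynomials to the polynomials themselves.\<close>

lemma affine_nonneg_limits:
  fixes a b :: real
  assumes "\<And>t. t > 0 \<Longrightarrow> a + t * b \<ge> 0"
  shows "a \<ge> 0" "b \<ge> 0"
proof -
  show "b \<ge> 0"
  proof (rule ccontr)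
    assume "\<not> b \<ge> 0"
    then have "((\<bar>a\<bar> + 1) / - b) * b = - (\<bar>a\<bar> + 1)" and "(\<bar>a\<bar> + 1) / - b > 0"
      by (auto intro!: divide_pos_neg)
    with assms[of "(\<bar>a\<bar> + 1) / - b"] show False
      by simp
  qed
  show "a \<ge> 0"
  proof (rule ccontr)
    assume a: "\<not> a \<ge> 0"
    \<comment> \<open>Small enough that \<open>t * b\<close> compensates at most half of the
      negative \<open>a\<close>.\<close>
    define t where "t = - a / (2 * (\<bar>b\<bar> + 1))"
    have "t > 0"
      using a by (auto simp: t_def intro!: divide_neg_pos)
    have "t * b \<le> t * (\<bar>b\<bar> + 1)"
      using \<open>t > 0\<close> by (intro mult_left_mono) auto
    also have "\<dots> = - a / 2"
      by (simp add: t_def field_simps)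
    finally show False
      using a assms[OF \<open>t > 0\<close>] by simp
  qed
qed

lemma nonneg_coeffs_limits:
  assumes "\<And>t. t > 0 \<Longrightarrow> nonneg_coeffs (A + smult t B)"
  shows "nonneg_coeffs A" "nonneg_coeffs B"
proof -
  have "coeff A i + t * coeff B i \<ge> 0" if "t > 0" for i t
    using assms[OF that] by (simp add: nonneg_coeffs_def)
  then show "nonneg_coeffs A" "nonneg_coeffs B"
    unfolding nonneg_coeffs_def using affine_nonneg_limits by blast+
qed

section \<open>Zeros in the upper half plane\<close>

definition zero_free :: "real poly \<Rightarrow> bool" where
  "zero_free A \<longleftrightarrow> (\<forall>x. Im x > 0 \<longrightarrow> ceval A x \<noteq> 0)"

text \<open>Zeros of a real polynomial come in conjugate pairs, so it is enough to look at the open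
  upper half plane.\<close>

lemma only_real_zeros_iff: "only_real_zeros A \<longleftrightarrow> A = 0 \<or> zero_free A"
proof -
  have "(\<forall>z. ceval A z = 0 \<longrightarrow> z \<in> \<real>) \<longleftrightarrow> zero_free A"
  proof
    assume "\<forall>z. ceval A z = 0 \<longrightarrow> z \<in> \<real>"
    then show "zero_free A"
      by (auto simp: zero_free_def complex_is_Real_iff)
  next
    assume A: "zero_free A"
    show "\<forall>z. ceval A z = 0 \<longrightarrow> z \<in> \<real>"
    proof (intro allI impI)
      fix z assume "ceval A z = 0"
      then have "ceval A z = 0" "ceval A (cnj z) = 0"
        by (simp_all add: ceval_cnj)
      with A have "\<not> Im z > 0" "\<not> Im (cnj z) > 0"
        unfolding zero_free_def by blast+
      then show "z \<in> \<real>"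
        by (simp add: complex_is_Real_iff)
    qed
  qed
  then show ?thesis
    by (simp add: only_real_zeros_def ceval_def)
qed

lemma real_rooted_factorization:
  assumes "only_real_zeros A" "A \<noteq> 0"
  shows "A = smult (lead_coeff A) (\<Prod>r\<in>#proots A. [:- r, 1:])" "size (proots A) = degree A"
proof -
  have "\<exists>M c. A = smult c (\<Prod>r\<in>#M. [:- r, 1:])"
    using assms
  proof (induction "degree A" arbitrary: A)
    case 0
    then obtain c where "A = [:c:]"
      by (metis degree_eq_zeroE)
    then have "A = smult c (\<Prod>r\<in>#{#}. [:- r, 1:])"
      by simp
    then show ?case
      by blast
  next
    case (Suc n)
    have "degree (map_poly complex_of_real A) = Suc n"
      using Suc.hyps by (simp add: degree_map_poly)
    then have "\<not> constant (poly (map_poly complex_of_real A))"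
      by (simp add: constant_degree)
    then obtain z where z: "ceval A z = 0"
      using fundamental_theorem_of_algebra unfolding ceval_def by blast
    with Suc.prems have "z \<in> \<real>"
      by (auto simp: only_real_zeros_def ceval_def)
    then obtain r where r: "z = of_real r"
      by (auto elim: Reals_cases)
    with z have "poly A r = 0"
      by (simp add: ceval_of_real)
    then obtain B where B: "A = [:- r, 1:] * B"
      by (auto simp: poly_eq_0_iff_dvd)
    with Suc.prems have "B \<noteq> 0"
      by auto
    then have "degree B = n"
      using Suc.hyps(2) degree_mult_eq[of "[:- r, 1:]" B] by (simp add: B del: mult_pCons_left)
    moreover have "only_real_zeros B"
      using Suc.prems by (simp add: only_real_zeros_iff zero_free_def B del: mult_pCons_left)
    ultimately obtain M c where "B = smult c (\<Prod>r\<in>#M. [:- r, 1:])"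
      using Suc.hyps(1) \<open>B \<noteq> 0\<close> by blast
    then have "A = smult c (\<Prod>r\<in>#add_mset r M. [:- r, 1:])"
      by (simp add: B mult_smult_right del: mult_pCons_left)
    then show ?case
      by blast
  qed
  then obtain M c where A: "A = smult c (\<Prod>r\<in>#M. [:- r, 1:])"
    by blast
  with \<open>A \<noteq> 0\<close> have c: "c \<noteq> 0"
    by auto
  have [simp]: "\<And>N. (\<Sum>x\<in>#N. {#x::real#}) = N"
    by (induct_tac N) auto
  have "proots (\<Prod>r\<in>#M. [:- r, 1:]) = (\<Sum>p\<in>#image_mset (\<lambda>r. [:- r, 1:]) M. proots p)"
    using proots_prod_mset[of "image_mset (\<lambda>r. [:- r, 1:]) M"]
    by (simp add: image_iff eq_commute[of 0])
  then have M: "proots A = M"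
    using c by (simp add: A image_mset.compositionality comp_def)
  have lc: "lead_coeff (\<Prod>r\<in>#N. [:- r, 1:]) = (1::real) \<and> degree (\<Prod>r\<in>#N. [:- r, 1:]) = size N" for N
  proof (induction N)
    case (add r N)
    then have "(\<Prod>r\<in>#N. [:- r, 1:]) \<noteq> (0 :: real poly)"
      by auto
    with add show ?case
      using degree_mult_eq[of "[:- r, 1:]" "\<Prod>r\<in>#N. [:- r, 1:]"]
        lead_coeff_mult[of "[:- r, 1:]" "\<Prod>r\<in>#N. [:- r, 1:]"]
      by (auto simp del: mult_pCons_left)
  qed simp
  have "lead_coeff A = c"
    using lc[of M] c by (auto simp: A)
  then show "A = smult (lead_coeff A) (\<Prod>r\<in>#proots A. [:- r, 1:])"
    unfolding M by (simp only: A[symmetric])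
  show "size (proots A) = degree A"
    using lc[of M] c M A by simp
qed

text \<open>A factor \<open>[:- r, 1:]\<close> with \<open>r \<le> 0\<close> has nonnegative
  coefficients; conversely a nonzero polynomial with nonnegative coefficients is positive on the
  positive axis. The sign conditions thus become a condition closed under sums and products.\<close>

lemma standard_nonpos_zeros_iff:
  "standard A \<and> only_nonpos_zeros A \<longleftrightarrow> A = 0 \<or> nonneg_coeffs A \<and> zero_free A"
proof (cases "A = 0")
  case False
  show ?thesis
  proof
    assume L: "standard A \<and> only_nonpos_zeros A"
    then have rr: "only_real_zeros A"
      using False by (auto simp: only_nonpos_zeros_def)
    have "- r \<ge> 0" if "r \<in># proots A" for r
      using that L False by (auto simp: only_nonpos_zeros_def)
    then have "nonneg_coeffs (smult (lead_coeff A) (\<Prod>r\<in>#proots A. [:- r, 1:]))"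
      using L False
      by (intro nonneg_coeffs_smult nonneg_coeffs_prod_mset) (auto simp: standard_def)
    then show "A = 0 \<or> nonneg_coeffs A \<and> zero_free A"
      using real_rooted_factorization[OF rr False] rr False by (simp add: only_real_zeros_iff)
  next
    assume "A = 0 \<or> nonneg_coeffs A \<and> zero_free A"
    with False have A: "nonneg_coeffs A" "zero_free A"
      by auto
    have "x \<le> 0" if "poly A x = 0" for x
      using nonneg_coeffs_poly_pos[OF A(1) False, of x] that by force
    then show "standard A \<and> only_nonpos_zeros A"
      using A False nonneg_coeffs_lead_coeff[OF A(1)]
      by (simp add: standard_def only_nonpos_zeros_def only_real_zeros_iff)
  qed
qed (simp add: standard_def only_nonpos_zeros_def)

lemma proots_nonpos:
  assumes "nonneg_coeffs A" "A \<noteq> 0" "r \<in># proots A"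
  shows "r \<le> 0"
  using nonneg_coeffs_poly_pos[OF assms(1,2), of r] assms by force

lemma ceval_factorization:
  assumes "zero_free A" "A \<noteq> 0"
  shows "ceval A x = of_real (lead_coeff A) * (\<Prod>r\<in>#proots A. x - of_real r)"
proof -
  have "only_real_zeros A"
    using assms by (simp add: only_real_zeros_iff)
  from real_rooted_factorization(1)[OF this assms(2)]
  have "ceval A x = ceval (smult (lead_coeff A) (\<Prod>r\<in>#proots A. [:- r, 1:])) x"
    by simp
  also have "\<dots> = of_real (lead_coeff A) * (\<Prod>r\<in>#proots A. x - of_real r)"
    by (simp add: ceval_prod_mset image_mset.compositionality comp_def)
  finally show ?thesis .
qed

text \<open>The parallelogram spanned by \<open>x\<close> and \<open>x + s\<close> has area
  \<open>s * Im x\<close>, so \<open>norm x * norm (x + s)\<close> is at least that; the bound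
  averages this with \<open>norm (x + s) \<ge> Im x\<close>.\<close>

lemma norm_add_real_ge:
  fixes s :: real
  assumes "Im x > 0" "s \<ge> 0"
  shows "norm (x + of_real s) \<ge> Im x / (2 * norm x) * (norm x + s)"
proof -
  have nz: "norm x > 0"
    using assms by auto
  have 1: "norm (x + of_real s) \<ge> Im x"
    using abs_Im_le_cmod[of "x + of_real s"] by simp
  have "(s * Im x)\<^sup>2 \<le> (norm x * norm (x + of_real s))\<^sup>2"
  proof -
    have "(norm x * norm (x + of_real s))\<^sup>2 - (s * Im x)\<^sup>2 = ((Re x)\<^sup>2 + (Im x)\<^sup>2 + s * Re x)\<^sup>2"
      by (simp add: power_mult_distrib cmod_power2) (simp add: power2_eq_square algebra_simps)
    then show ?thesis
      by (smt (verit) zero_le_power2)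
  qed
  then have "s * Im x \<le> norm x * norm (x + of_real s)"
    by (rule power2_le_imp_le) simp
  then have 2: "norm (x + of_real s) \<ge> s * Im x / norm x"
    using nz by (simp add: field_simps)
  have "Im x / (2 * norm x) * (norm x + s) = (Im x + s * Im x / norm x) / 2"
    using nz by (simp add: field_simps)
  with add_mono[OF 1 2] show ?thesis
    by simp
qed

text \<open>Compared with its value at the positive point \<open>norm x\<close>, each linear factor
  loses at most the constant factor of \<open>norm_add_real_ge\<close>. The bound sees
  \<open>A\<close> only through its degree and one positive value, so it survives limits.\<close>

lemma norm_ceval_ge:
  assumes "nonneg_coeffs A" "zero_free A" "Im x > 0"
  shows "norm (ceval A x) \<ge> (Im x / (2 * norm x)) ^ degree A * poly A (norm x)"
proof (cases "A = 0")
  case False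
  let ?c = "Im x / (2 * norm x)"
  have rr: "only_real_zeros A"
    using assms False by (simp add: only_real_zeros_iff)
  have c: "?c \<ge> 0"
    using assms by simp
  have "(\<Prod>r\<in>#M. norm (x - of_real r)) \<ge> ?c ^ size M * (\<Prod>r\<in>#M. norm x - r) \<and> (\<Prod>r\<in>#M. norm x - r) \<ge> 0"
    if "\<And>r. r \<in># M \<Longrightarrow> r \<le> 0" for M
    using that
  proof (induction M)
    case (add r M)
    then have IH: "(\<Prod>r\<in>#M. norm (x - of_real r)) \<ge> ?c ^ size M * (\<Prod>r\<in>#M. norm x - r)"
        "(\<Prod>r\<in>#M. norm x - r) \<ge> 0"
      by auto
    have r: "r \<le> 0"
      using add.prems by simp
    have "norm (x - of_real r) \<ge> ?c * (norm x - r)"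
      using norm_add_real_ge[OF assms(3), of "- r"] r by simp
    with IH r c have "(?c * (norm x - r)) * (?c ^ size M * (\<Prod>r\<in>#M. norm x - r))
        \<le> norm (x - of_real r) * (\<Prod>r\<in>#M. norm (x - of_real r))"
      by (intro mult_mono mult_nonneg_nonneg zero_le_power) auto
    moreover have "norm x - r \<ge> 0"
      using r norm_ge_zero[of x] by linarith
    ultimately show ?case
      using IH by (auto simp: mult_ac)
  qed simp
  from this[of "proots A"] have M: "(\<Prod>r\<in>#proots A. norm (x - of_real r)) \<ge> ?c ^ degree A * (\<Prod>r\<in>#proots A. norm x - r)"
    using proots_nonpos[OF assms(1) False] real_rooted_factorization(2)[OF rr False] by force
  have nrm: "norm (\<Prod>r\<in>#N. x - complex_of_real r) = (\<Prod>r\<in>#N. norm (x - of_real r))" for N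
    by (induction N) (simp_all add: norm_mult)
  have "poly A (norm x) = lead_coeff A * (\<Prod>r\<in>#proots A. norm x - r)"
    by (subst real_rooted_factorization(1)[OF rr False])
       (simp add: poly_prod_mset image_mset.compositionality comp_def)
  moreover have "norm (ceval A x) = lead_coeff A * (\<Prod>r\<in>#proots A. norm (x - of_real r))"
    using nonneg_coeffs_lead_coeff[OF assms(1) False]
    by (simp add: ceval_factorization[OF assms(2) False] norm_mult nrm)
  ultimately show ?thesis
    using M nonneg_coeffs_lead_coeff[OF assms(1) False] by (simp add: mult_ac)
qed simp

lemma zero_free_limit:
  assumes "\<And>t. t > 0 \<Longrightarrow> nonneg_coeffs (A + smult t B) \<and> zero_free (A + smult t B)"
    and "A \<noteq> 0"
  shows "zero_free A"
  unfolding zero_free_def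
proof (intro allI impI)
  fix x :: complex assume x: "Im x > 0"
  have nA: "nonneg_coeffs A" and nB: "nonneg_coeffs B"
    using nonneg_coeffs_limits[of A B] assms by blast+
  have nx: "norm x > 0"
    using x by auto
  define c where "c = Im x / (2 * norm x)"
  \<comment> \<open>The degree may drop in the limit; since \<open>c \<le> 1\<close>, one exponent
    \<open>D\<close> serves all \<open>t\<close>.\<close>
  define D where "D = max (degree A) (degree B)"
  have c: "0 < c" "c \<le> 1"
    using x nx abs_Im_le_cmod[of x] by (auto simp: c_def field_simps)
  have bound: "norm (ceval A x) + t * norm (ceval B x) \<ge> c ^ D * poly A (norm x)" if t: "t > 0" for t
  proof -
    let ?T = "A + smult t B"
    have "degree ?T \<le> D"
      by (auto simp: D_def intro!: degree_add_le)
    then have "c ^ D \<le> c ^ degree ?T"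
      using c by (intro power_decreasing) auto
    moreover have "poly A (norm x) \<ge> 0" "poly B (norm x) \<ge> 0"
      using nA nB by (auto simp: poly_altdef nonneg_coeffs_def intro!: sum_nonneg)
    then have "poly ?T (norm x) \<ge> poly A (norm x)" "poly A (norm x) \<ge> 0"
      using t by simp_all
    ultimately have "c ^ D * poly A (norm x) \<le> c ^ degree ?T * poly ?T (norm x)"
      using c by (intro mult_mono) auto
    also have "\<dots> \<le> norm (ceval ?T x)"
      unfolding c_def using assms(1)[OF t] x by (intro norm_ceval_ge) auto
    also have "\<dots> \<le> norm (ceval A x) + t * norm (ceval B x)"
      using norm_triangle_ineq[of "ceval A x" "of_real t * ceval B x"] t by (simp add: norm_mult)
    finally show ?thesis .
  qed
  have "norm (ceval A x) - c ^ D * poly A (norm x) \<ge> 0"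
    by (rule affine_nonneg_limits(1)[of _ "norm (ceval B x)"]) (use bound in \<open>simp add: algebra_simps\<close>)
  moreover have "c ^ D * poly A (norm x) > 0"
    using c nonneg_coeffs_poly_pos[OF nA assms(2) nx] by simp
  ultimately show "ceval A x \<noteq> 0"
    by auto
qed

section \<open>Interlacing and angles\<close>


text \<open>For \<open>c = s + t x\<close> with \<open>Im x > 0\<close> the two imaginary parts are
  \<open>t * Im x\<close> and \<open>s * Im x\<close>, so these are the coordinate conditions
  \<open>s, t \<ge> 0\<close>; being linear in \<open>c\<close>, they add up and pass to
  limits.\<close>

definition cone :: "complex \<Rightarrow> complex \<Rightarrow> bool" where
  "cone x c \<longleftrightarrow> 0 \<le> Im c \<and> 0 \<le> Im (x * cnj c)"

text \<open>The argument of \<open>x - r\<close> for \<open>x\<close> in the upper half plane.\<close>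
definition ang :: "complex \<Rightarrow> real \<Rightarrow> real" where
  "ang x r = pi / 2 - arctan ((Re x - r) / Im x)"

definition Ang :: "complex \<Rightarrow> real multiset \<Rightarrow> real" where
  "Ang x M = (\<Sum>r\<in>#M. ang x r)"

lemma Ang_simps [simp]: "Ang x {#} = 0" "Ang x (add_mset r M) = ang x r + Ang x M"
  by (simp_all add: Ang_def)

lemma ang_bounds: "0 < ang x r" "ang x r < pi"
  using arctan_bounded[of "(Re x - r) / Im x"] by (auto simp: ang_def)

lemma ang_mono: "Im x > 0 \<Longrightarrow> r \<le> s \<Longrightarrow> ang x r \<le> ang x s"
  by (simp add: ang_def arctan_le_iff divide_right_mono)

lemma diff_eq_cis_ang:
  assumes "Im x > 0"
  shows "x - of_real r = of_real (norm (x - of_real r)) * cis (ang x r)"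
proof -
  define t where "t = (Re x - r) / Im x"
  have 1: "norm (x - of_real r) = Im x * sqrt (1 + t\<^sup>2)"
  proof -
    have "(Re x - r)\<^sup>2 + (Im x)\<^sup>2 = (Im x)\<^sup>2 * (1 + t\<^sup>2)"
      using assms by (simp add: t_def field_simps power_divide)
    then show ?thesis
      using assms by (simp add: cmod_def real_sqrt_mult)
  qed
  have "sqrt (1 + t\<^sup>2) \<noteq> 0"
    by (metis add_nonneg_eq_0_iff less_irrefl real_sqrt_eq_0_iff zero_le_one zero_le_power2 zero_less_one)
  then have "cos (ang x r) = t / sqrt (1 + t\<^sup>2)" "sin (ang x r) = 1 / sqrt (1 + t\<^sup>2)"
    by (simp_all add: ang_def t_def[symmetric] cos_diff sin_diff sin_arctan cos_arctan)
  moreover have "Im x * t = Re x - r"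
    using assms by (simp add: t_def)
  ultimately show ?thesis
    using \<open>sqrt (1 + t\<^sup>2) \<noteq> 0\<close> unfolding 1 by (simp add: complex_eq_iff)
qed

lemma prod_diff_eq_cis_Ang:
  assumes "Im x > 0"
  shows "(\<Prod>r\<in>#M. x - of_real r) = of_real (\<Prod>r\<in>#M. norm (x - of_real r)) * cis (Ang x M)"
    and "(\<Prod>r\<in>#M. norm (x - of_real r)) > 0"
proof -
  show "(\<Prod>r\<in>#M. x - of_real r) = of_real (\<Prod>r\<in>#M. norm (x - of_real r)) * cis (Ang x M)"
  proof (induction M)
    case (add r M)
    have "(\<Prod>r\<in>#add_mset r M. x - of_real r)
        = (of_real (norm (x - of_real r)) * cis (ang x r)) * (\<Prod>r\<in>#M. x - of_real r)"
      using diff_eq_cis_ang[OF assms, of r] by simp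
    then show ?case
      by (simp only: add.IH) (simp add: cis_mult[symmetric] mult_ac)
  qed simp
  show "(\<Prod>r\<in>#M. norm (x - of_real r)) > 0"
  proof (induction M)
    case (add r M)
    have "x - of_real r \<noteq> 0"
      using assms by (auto simp: complex_eq_iff)
    with add show ?case
      by simp
  qed simp
qed

text \<open>The phase is a difference of real angle sums, not a class modulo \<open>2 * pi\<close>,
  and can therefore be followed continuously in \<open>x\<close>.\<close>

lemma phase_polar:
  assumes "nonneg_coeffs A" "zero_free A" "A \<noteq> 0" "nonneg_coeffs B" "zero_free B" "B \<noteq> 0"
    and "Im x > 0"
  obtains R where "R > 0"
    "ceval B x * cnj (ceval A x) = of_real R * cis (Ang x (proots B) - Ang x (proots A))"
proof
  let ?n = "\<lambda>M. \<Prod>r\<in>#M. norm (x - of_real r)"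
  let ?R = "lead_coeff B * ?n (proots B) * (lead_coeff A * ?n (proots A))"
  show "?R > 0"
    using assms by (simp add: nonneg_coeffs_lead_coeff prod_diff_eq_cis_Ang(2))
  have "ceval T x = of_real (lead_coeff T * ?n (proots T)) * cis (Ang x (proots T))"
    if "zero_free T" "T \<noteq> 0" for T
    by (simp add: ceval_factorization[OF that] prod_diff_eq_cis_Ang(1)[OF assms(7)])
  then have "ceval B x * cnj (ceval A x) = of_real ?R * (cis (Ang x (proots B)) * cnj (cis (Ang x (proots A))))"
    using assms by (simp add: mult_ac)
  then show "ceval B x * cnj (ceval A x) = of_real ?R * cis (Ang x (proots B) - Ang x (proots A))"
    by (simp only: cis_cnj cis_mult) simp
qed

section \<open>Boundary values of angles and zero counts\<close>

lemma ang_tendsto: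
  "r < t \<Longrightarrow> ((\<lambda>e. ang (Complex t e) r) \<longlongrightarrow> 0) (at_right 0)"
  "t < r \<Longrightarrow> ((\<lambda>e. ang (Complex t e) r) \<longlongrightarrow> pi) (at_right 0)"
proof -
  have lim: "((\<lambda>e. arctan (c / e)) \<longlongrightarrow> pi / 2) (at_right 0)" if "c > 0" for c :: real
  proof -
    have "LIM e at_right 0. c * inverse e :> at_top"
      by (rule filterlim_tendsto_pos_mult_at_top[OF tendsto_const that filterlim_inverse_at_top_right])
    then have "LIM e at_right 0. c / e :> at_top"
      by (simp only: divide_inverse)
    then show ?thesis
      by (rule filterlim_compose[OF tendsto_arctan_at_top])
  qed
  show "((\<lambda>e. ang (Complex t e) r) \<longlongrightarrow> 0) (at_right 0)" if "r < t"
    using tendsto_diff[OF tendsto_const[of "pi / 2"] lim[of "t - r"]] that by (simp add: ang_def)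
  show "((\<lambda>e. ang (Complex t e) r) \<longlongrightarrow> pi) (at_right 0)" if "t < r"
  proof -
    have "ang (Complex t e) r = pi / 2 + arctan ((r - t) / e)" for e
      using arctan_minus[of "(r - t) / e"] by (simp add: ang_def minus_divide_left)
    then show ?thesis
      using tendsto_add[OF tendsto_const[of "pi / 2"] lim[of "r - t"]] that by simp
  qed
qed

abbreviation above :: "real \<Rightarrow> real multiset \<Rightarrow> nat" where
  "above t M \<equiv> size (filter_mset (\<lambda>r. t < r) M)"

text \<open>A zero to the right of \<open>t\<close> is finally seen under the angle
  \<open>pi\<close>, one to the left under the angle 0.\<close>

lemma Ang_tendsto:
  assumes "t \<notin># M"
  shows "((\<lambda>e. Ang (Complex t e) M) \<longlongrightarrow> pi * above t M) (at_right 0)"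
  using assms
proof (induction M)
  case (add r M)
  then have IH: "((\<lambda>e. Ang (Complex t e) M) \<longlongrightarrow> pi * above t M) (at_right 0)"
    by simp
  consider "r < t" | "t < r"
    using add.prems by fastforce
  then show ?case
  proof cases
    case 1
    with tendsto_add[OF ang_tendsto(1)[OF 1] IH] show ?thesis
      by simp
  next
    case 2
    with tendsto_add[OF ang_tendsto(2)[OF 2] IH] show ?thesis
      by (simp add: algebra_simps)
  qed
qed simp

lemma continuous_on_Ang:
  assumes "continuous_on S a" "continuous_on S b" "\<And>s. s \<in> S \<Longrightarrow> b s > 0"
  shows "continuous_on S (\<lambda>s. Ang (Complex (a s) (b s)) M)"
proof (induction M)
  case (add r M)
  have "continuous_on S (\<lambda>s. ang (Complex (a s) (b s)) r)"
    using assms by (auto simp: ang_def intro!: continuous_intros) fastforce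
  with add show ?case
    by (auto intro!: continuous_intros)
qed simp

text \<open>The difference is continuous in \<open>x\<close> and never equals \<open>pi\<close>,
  where \<open>cis\<close> would be \<open>-1\<close>; near the real point 1, which lies to the
  right of all zeros, it is close to 0.\<close>

lemma Ang_diff_less_pi:
  assumes M: "\<And>r. r \<in># M \<Longrightarrow> r \<le> 0" and N: "\<And>r. r \<in># N \<Longrightarrow> r \<le> 0"
    and cis: "\<And>x. Im x > 0 \<Longrightarrow> cis (Ang x N - Ang x M) \<noteq> -1"
    and x: "Im x > 0"
  shows "Ang x N - Ang x M < pi"
proof (rule ccontr)
  assume "\<not> Ang x N - Ang x M < pi"
  then have ge: "Ang x N - Ang x M \<ge> pi"
    by simp
  have z: "above 1 M = 0" "above 1 N = 0" and "1 \<notin># M" "1 \<notin># N"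
    using M N by force+
  then have "((\<lambda>e. Ang (Complex 1 e) N - Ang (Complex 1 e) M) \<longlongrightarrow> 0) (at_right 0)"
    using tendsto_diff[OF Ang_tendsto[of 1 N] Ang_tendsto[of 1 M]] unfolding z by simp
  then have "\<forall>\<^sub>F e in at_right 0. Ang (Complex 1 e) N - Ang (Complex 1 e) M < pi"
    by (rule order_tendstoD) simp
  then have "\<forall>\<^sub>F e in at_right 0. (0::real) < e \<and> Ang (Complex 1 e) N - Ang (Complex 1 e) M < pi"
    using eventually_at_right_less[of "0::real"] by eventually_elim simp
  then obtain e where e: "e > 0" "Ang (Complex 1 e) N - Ang (Complex 1 e) M < pi"
    using eventually_happens' trivial_limit_at_right_real by blast
  \<comment> \<open>A segment in the upper half plane from a point just above 1 to
    \<open>x\<close>.\<close>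
  define z where "z s = Complex (1 + s * (Re x - 1)) (e + s * (Im x - e))" for s
  have pos: "e + s * (Im x - e) > 0" if "s \<in> {0..1}" for s
  proof -
    have "e + s * (Im x - e) = (1 - s) * e + s * Im x"
      by (simp add: algebra_simps)
    moreover have "(1 - s) * e + s * Im x > 0"
    proof (cases "s = 0")
      case False
      with that e x show ?thesis
        by (intro add_nonneg_pos mult_nonneg_nonneg mult_pos_pos) auto
    qed (use e in simp)
    ultimately show ?thesis
      by simp
  qed
  have "continuous_on {0..1} (\<lambda>s. Ang (z s) N - Ang (z s) M)"
    unfolding z_def by (intro continuous_on_diff continuous_on_Ang continuous_intros pos)
  moreover have "z 0 = Complex 1 e" "z 1 = x"
    by (simp_all add: z_def complex_eq_iff)
  ultimately obtain s where s: "0 \<le> s" "s \<le> 1" "Ang (z s) N - Ang (z s) M = pi"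
    using IVT'[of "\<lambda>s. Ang (z s) N - Ang (z s) M" 0 pi 1] e ge by auto
  have "Im (z s) > 0"
    using pos[of s] s by (simp add: z_def)
  from cis[OF this] s(3) show False
    by (simp add: cis_pi)
qed

text \<open>At a boundary point \<open>t < 0\<close> the angle difference is \<open>pi\<close> times
  the difference of the counts. The bound by \<open>pi\<close> for the pair \<open>M\<close>,
  \<open>N\<close> gives the second claim; for the pair \<open>N\<close>,
  \<open>add_mset 0 M\<close> it gives \<open>above t M + 1 - above t N \<le> 1\<close>, the first
  claim.\<close>

lemma above_bounds:
  assumes M: "\<And>r. r \<in># M \<Longrightarrow> r \<le> 0" and N: "\<And>r. r \<in># N \<Longrightarrow> r \<le> 0"
    and cis1: "\<And>x. Im x > 0 \<Longrightarrow> cis (Ang x N - Ang x M) \<noteq> -1"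
    and cis2: "\<And>x. Im x > 0 \<Longrightarrow> cis (Ang x N - Ang x M - ang x 0) \<noteq> -1"
  shows "above t M \<le> above t N" "above t N \<le> above t M + 1"
proof -
  have upper: "Ang x N - Ang x M < pi" if "Im x > 0" for x
    using that by (intro Ang_diff_less_pi M N cis1)
  have lower: "Ang x (add_mset 0 M) - Ang x N < pi" if "Im x > 0" for x
  proof (rule Ang_diff_less_pi)
    fix x assume "Im x > 0"
    from cis2[OF this] show "cis (Ang x (add_mset 0 M) - Ang x N) \<noteq> -1"
      using cis_cnj[of "Ang x N - Ang x M - ang x 0"]
      by (metis (no_types, opaque_lifting) Ang_simps(2) complex_cnj_cnj complex_cnj_minus complex_cnj_one
          add.commute diff_diff_eq minus_diff_eq)
  qed (use M N that in auto)
  have gen: "above t M \<le> above t N \<and> above t N \<le> above t M + 1" if t: "t < 0" "t \<notin># M" "t \<notin># N" for t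
  proof
    have ev: "\<forall>\<^sub>F e in at_right 0. Im (Complex t e) > 0"
      using eventually_at_right_less[of "0::real"] by eventually_elim simp
    have "((\<lambda>e. Ang (Complex t e) N - Ang (Complex t e) M) \<longlongrightarrow> pi * above t N - pi * above t M) (at_right 0)"
      by (intro tendsto_diff Ang_tendsto t)
    moreover from ev have "\<forall>\<^sub>F e in at_right 0. Ang (Complex t e) N - Ang (Complex t e) M \<le> pi"
      by eventually_elim (intro less_imp_le upper)
    ultimately have "pi * above t N - pi * above t M \<le> pi"
      by (rule tendsto_upperbound) (simp add: trivial_limit_at_right_real)
    then have "pi * above t N \<le> pi * (above t M + 1)"
      by (simp add: algebra_simps)
    then show "above t N \<le> above t M + 1"
      by (simp only: mult_le_cancel_left_pos pi_gt_zero of_nat_le_iff)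
    have "((\<lambda>e. Ang (Complex t e) (add_mset 0 M) - Ang (Complex t e) N)
        \<longlongrightarrow> pi * above t (add_mset 0 M) - pi * above t N) (at_right 0)"
      using t by (intro tendsto_diff Ang_tendsto) auto
    moreover from ev have "\<forall>\<^sub>F e in at_right 0. Ang (Complex t e) (add_mset 0 M) - Ang (Complex t e) N \<le> pi"
      by eventually_elim (intro less_imp_le lower)
    ultimately have "pi * above t (add_mset 0 M) - pi * above t N \<le> pi"
      by (rule tendsto_upperbound) (simp add: trivial_limit_at_right_real)
    then have "pi * above t M \<le> pi * above t N"
      using t by (simp add: algebra_simps)
    then show "above t M \<le> above t N"
      by (simp only: mult_le_cancel_left_pos pi_gt_zero of_nat_le_iff)
  qed
  have "above t M \<le> above t N \<and> above t N \<le> above t M + 1"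
  proof (cases "t < 0")
    case True
    define S where "S = {r \<in> set_mset (M + N). r > t} \<union> {0}"
    have S: "finite S" "S \<noteq> {}" "Min S > t"
      using True by (auto simp: S_def)
    define t' where "t' = (t + Min S) / 2"
    have t': "t < t'" "t' < Min S"
      using S by (auto simp: t'_def)
    have *: "t < r \<longleftrightarrow> t' < r" "r \<noteq> t'" if "r \<in># M + N" for r
    proof -
      have "r \<in> S \<longrightarrow> Min S \<le> r" "t < r \<longrightarrow> r \<in> S"
        using S(1) that by (auto simp: S_def)
      then show "t < r \<longleftrightarrow> t' < r" "r \<noteq> t'"
        using t' by auto
    qed
    have "Min S \<le> 0"
      using S(1) by (intro Min_le) (auto simp: S_def)
    with t' have "t' < 0"
      by simp
    moreover have "t' \<notin># M" "t' \<notin># N"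
      using * by fastforce+
    moreover have "filter_mset (\<lambda>r. t < r) M = filter_mset (\<lambda>r. t' < r) M"
      "filter_mset (\<lambda>r. t < r) N = filter_mset (\<lambda>r. t' < r) N"
      using * by (auto intro!: filter_mset_cong)
    ultimately show ?thesis
      using gen[of t'] by simp
  next
    case False
    then have "above t M = 0" "above t N = 0"
      using M N by force+
    then show ?thesis
      by linarith
  qed
  then show "above t M \<le> above t N" "above t N \<le> above t M + 1"
    by auto
qed

lemma above_sorted:
  assumes "sorted xs" "i < length xs"
  shows "t < xs ! i \<Longrightarrow> above t (mset xs) \<ge> length xs - i"
    and "xs ! i \<le> t \<Longrightarrow> above t (mset xs) \<le> length xs - Suc i"
proof -
  have ab: "above t (mset xs) = length (filter ((<) t) (take j xs)) + length (filter ((<) t) (drop j xs))" for j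
  proof -
    have "above t (mset xs) = length (filter ((<) t) xs)"
      by (simp flip: mset_filter)
    also have "\<dots> = length (filter ((<) t) (take j xs @ drop j xs))"
      by simp
    finally show ?thesis
      by (simp only: filter_append length_append)
  qed
  show "above t (mset xs) \<ge> length xs - i" if "t < xs ! i"
  proof -
    have "\<forall>y \<in> set (drop i xs). t < y"
    proof
      fix y assume "y \<in> set (drop i xs)"
      then obtain k where k: "k < length xs - i" "y = xs ! (i + k)"
        by (auto simp: in_set_conv_nth)
      then have "xs ! i \<le> y"
        using sorted_nth_mono[OF assms(1), of i "i + k"] by simp
      with that show "t < y"
        by simp
    qed
    then have "filter ((<) t) (drop i xs) = drop i xs"
      by simp
    then show ?thesis
      by (simp add: ab[of i])
  qed
  show "above t (mset xs) \<le> length xs - Suc i" if "xs ! i \<le> t"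
  proof -
    have "\<forall>y \<in> set (take (Suc i) xs). \<not> t < y"
    proof
      fix y assume "y \<in> set (take (Suc i) xs)"
      then obtain k where k: "k \<le> i" "y = xs ! k"
        by (auto simp: in_set_conv_nth less_Suc_eq_le)
      then have "y \<le> xs ! i"
        using sorted_nth_mono[OF assms(1), of k i] assms(2) by simp
      with that show "\<not> t < y"
        by simp
    qed
    then have "filter ((<) t) (take (Suc i) xs) = []"
      by simp
    then show ?thesis
      using length_filter_le[of "(<) t" "drop (Suc i) xs"] by (simp add: ab[of "Suc i"])
  qed
qed

section \<open>Interlacing of sorted lists\<close>

definition interlacing_lists :: "real list \<Rightarrow> real list \<Rightarrow> bool" where
  "interlacing_lists xs ys \<longleftrightarrow>
     length ys = length xs + 1 \<and> (\<forall>i<length xs. ys ! i \<le> xs ! i \<and> xs ! i \<le> ys ! (i + 1)) \<or>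
     length xs = length ys \<and> (\<forall>i<length xs. xs ! i \<le> ys ! i \<and> (i + 1 < length xs \<longrightarrow> ys ! i \<le> xs ! (i + 1)))"

lemma interlaces_iff:
  assumes "zero_free A" "A \<noteq> 0" "zero_free B" "B \<noteq> 0"
  shows "A \<prec> B \<longleftrightarrow>
    interlacing_lists (sorted_list_of_multiset (proots A)) (sorted_list_of_multiset (proots B))"
proof -
  have len: "length (sorted_list_of_multiset (proots T)) = degree T" if "zero_free T" "T \<noteq> 0" for T
  proof -
    have "length (sorted_list_of_multiset (proots T)) = size (proots T)"
      by (metis mset_sorted_list_of_multiset size_mset)
    also have "\<dots> = degree T"
      using that by (intro real_rooted_factorization(2)) (auto simp: only_real_zeros_iff)
    finally show ?thesis .
  qed
  show ?thesis
    using assms len[OF assms(1,2)] len[OF assms(3,4)]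
    unfolding interlaces_def interlacing_lists_def Let_def only_real_zeros_iff by metis
qed

text \<open>A violated inequality between an \<open>xs ! i\<close> and a \<open>ys ! j\<close>
  contradicts the bound on the counts at the smaller of the two.\<close>

lemma interlacing_listsI:
  assumes "sorted xs" "sorted ys"
    and le: "\<And>t. above t (mset xs) \<le> above t (mset ys)"
    and ge: "\<And>t. above t (mset ys) \<le> above t (mset xs) + 1"
  shows "interlacing_lists xs ys"
proof -
  \<comment> \<open>Below all entries, where the counts are the lengths; the inserted 0 keeps
    \<open>Min\<close> meaningful for empty lists.\<close>
  define t where "t = Min (insert 0 (set (xs @ ys))) - 1"
  have t: "t < r" if "r \<in> set (xs @ ys)" for r
  proof -
    have "Min (insert 0 (set (xs @ ys))) \<le> r"
      using that by (intro Min_le) auto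
    then show ?thesis
      by (simp add: t_def)
  qed
  then have "above t (mset xs) = length xs" "above t (mset ys) = length ys"
    by (simp_all flip: mset_filter)
  with le[of t] ge[of t] have len: "length ys = length xs + 1 \<or> length xs = length ys"
    by auto
  \<comment> \<open>\<open>length ys - j\<close> is the position of \<open>ys ! j\<close> counted
    from the largest entry; in this form the next two facts serve both degree cases.\<close>
  have 1: "ys ! j \<le> xs ! i" if "i < length xs" "j < length ys" "length ys - j > length xs - i" for i j
  proof (rule ccontr)
    assume "\<not> ys ! j \<le> xs ! i"
    then have "above (xs ! i) (mset ys) \<ge> length ys - j" "above (xs ! i) (mset xs) \<le> length xs - Suc i"
      using above_sorted assms(1,2) that by auto
    with ge[of "xs ! i"] that show False
      by linarith
  qed
  have 2: "xs ! i \<le> ys ! j" if "i < length xs" "j < length ys" "length xs - i > length ys - Suc j" for i j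
  proof (rule ccontr)
    assume "\<not> xs ! i \<le> ys ! j"
    then have "above (ys ! j) (mset xs) \<ge> length xs - i" "above (ys ! j) (mset ys) \<le> length ys - Suc j"
      using above_sorted assms(1,2) that by auto
    with le[of "ys ! j"] that show False
      by linarith
  qed
  from len show ?thesis
  proof
    assume "length ys = length xs + 1"
    then show ?thesis
      unfolding interlacing_lists_def by (intro disjI1 conjI allI impI 1 2) simp_all
  next
    assume "length xs = length ys"
    then show ?thesis
      unfolding interlacing_lists_def by (intro disjI2 conjI allI impI 1 2) simp_all
  qed
qed

text \<open>Angles increase with the zeros, so neighbours in the interlacing order compare termwise.
  What remains unpaired is one angle, or a difference of two, and as all zeros are nonpositive each
  angle is at most \<open>ang x 0\<close>.\<close>

lemma Ang_bounds_interlacing: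
  assumes "interlacing_lists xs ys" "Im x > 0"
    and "\<And>r. r \<in> set ys \<Longrightarrow> r \<le> 0" "\<And>r. r \<in> set xs \<Longrightarrow> r \<le> 0"
  shows "0 \<le> Ang x (mset ys) - Ang x (mset xs)" "Ang x (mset ys) - Ang x (mset xs) \<le> ang x 0"
proof -
  have Ang: "Ang x (mset zs) = (\<Sum>i<length zs. ang x (zs ! i))" for zs
    unfolding Ang_def
    by (metis (mono_tags, lifting) atLeast0LessThan length_map mset_map nth_map sum.cong sum_list_sum_nth
        sum_mset_sum_list lessThan_iff)
  have le0: "ang x r \<le> ang x 0" if "r \<in> set ys \<union> set xs" for r
    using assms that by (intro ang_mono) auto
  note mono = ang_mono[OF assms(2)]
  have "0 \<le> Ang x (mset ys) - Ang x (mset xs) \<and> Ang x (mset ys) - Ang x (mset xs) \<le> ang x 0"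
    using assms(1) unfolding interlacing_lists_def
  proof
    assume *: "length ys = length xs + 1 \<and> (\<forall>i<length xs. ys ! i \<le> xs ! i \<and> xs ! i \<le> ys ! (i + 1))"
    let ?n = "length xs"
    have "Ang x (mset ys) = (\<Sum>i<?n. ang x (ys ! i)) + ang x (ys ! ?n)"
      using * by (simp add: Ang)
    moreover have "(\<Sum>i<?n. ang x (ys ! i)) \<le> Ang x (mset xs)"
      unfolding Ang using * by (intro sum_mono mono) auto
    moreover have "ang x (ys ! ?n) \<le> ang x 0"
      using * by (intro le0) auto
    moreover have "Ang x (mset ys) = ang x (ys ! 0) + (\<Sum>i<?n. ang x (ys ! Suc i))"
      using * by (simp only: Ang Suc_eq_plus1[symmetric] sum.lessThan_Suc_shift)
    moreover have "Ang x (mset xs) \<le> (\<Sum>i<?n. ang x (ys ! Suc i))"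
      unfolding Ang using * by (intro sum_mono mono) auto
    ultimately show ?thesis
      using ang_bounds(1)[of x "ys ! 0"] by linarith
  next
    assume *: "length xs = length ys \<and> (\<forall>i<length xs. xs ! i \<le> ys ! i \<and> (i + 1 < length xs \<longrightarrow> ys ! i \<le> xs ! (i + 1)))"
    have 1: "Ang x (mset xs) \<le> Ang x (mset ys)"
      using * by (simp add: Ang) (intro sum_mono mono, auto)
    show ?thesis
    proof (cases "length xs")
      case 0
      with * show ?thesis
        using ang_bounds(1)[of x 0] by simp
    next
      case (Suc n)
      with * have n: "length ys = Suc n"
        by simp
      have "Ang x (mset ys) = (\<Sum>i<n. ang x (ys ! i)) + ang x (ys ! n)"
        by (simp only: Ang n sum.lessThan_Suc)
      moreover have "(\<Sum>i<n. ang x (ys ! i)) \<le> (\<Sum>i<n. ang x (xs ! Suc i))"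
        using * Suc by (intro sum_mono mono) auto
      moreover have "Ang x (mset xs) = ang x (xs ! 0) + (\<Sum>i<n. ang x (xs ! Suc i))"
        by (simp only: Ang Suc sum.lessThan_Suc_shift)
      moreover have "ang x (ys ! n) \<le> ang x 0"
        using * Suc by (intro le0) auto
      ultimately show ?thesis
        using 1 ang_bounds(1)[of x "xs ! 0"] by linarith
    qed
  qed
  then show "0 \<le> Ang x (mset ys) - Ang x (mset xs)" "Ang x (mset ys) - Ang x (mset xs) \<le> ang x 0"
    by auto
qed

text \<open>\<open>ang x 0\<close> is the argument of \<open>x\<close>, so the cone is the sector of
  arguments between 0 and \<open>ang x 0\<close>.\<close>

lemma cone_polar:
  assumes "Im x > 0" "R \<ge> 0" "0 \<le> f" "f \<le> ang x 0"
  shows "cone x (of_real R * cis f)"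
proof -
  have "x = of_real (norm x) * cis (ang x 0)"
    using diff_eq_cis_ang[OF assms(1), of 0] by simp
  then have "x * cnj (of_real R * cis f) = of_real (norm x * R) * (cis (ang x 0) * cis (- f))"
    by (simp add: cis_cnj mult_ac)
  also have "\<dots> = of_real (norm x * R) * cis (ang x 0 - f)"
    by (simp only: cis_mult) simp
  finally have eq: "x * cnj (of_real R * cis f) = of_real (norm x * R) * cis (ang x 0 - f)" .
  have "Im (x * cnj (of_real R * cis f)) = norm x * R * sin (ang x 0 - f)"
    unfolding eq by simp
  then show ?thesis
    using assms ang_bounds(2)[of x 0] by (auto simp: cone_def intro!: mult_nonneg_nonneg sin_ge_zero)
qed

lemma interlaces_imp_cone:
  assumes "A \<prec> B" "nonneg_coeffs A" "zero_free A" "nonneg_coeffs B" "zero_free B" "A \<noteq> 0" "B \<noteq> 0"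
    and "Im x > 0"
  shows "cone x (ceval B x * cnj (ceval A x))"
proof -
  let ?xs = "sorted_list_of_multiset (proots A)" and ?ys = "sorted_list_of_multiset (proots B)"
  have "interlacing_lists ?xs ?ys"
    using assms by (simp add: interlaces_iff)
  then have "0 \<le> Ang x (mset ?ys) - Ang x (mset ?xs)" "Ang x (mset ?ys) - Ang x (mset ?xs) \<le> ang x 0"
    using proots_nonpos[OF assms(2,6)] proots_nonpos[OF assms(4,7)] assms(8)
    by (intro Ang_bounds_interlacing; simp)+
  moreover obtain R where "R > 0"
    "ceval B x * cnj (ceval A x) = of_real R * cis (Ang x (proots B) - Ang x (proots A))"
    using phase_polar[OF assms(2,3,6,4,5,7,8)] by blast
  ultimately show ?thesis
    using assms by (auto intro!: cone_polar)
qed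

text \<open>Only the two open rays opposite to \<open>1\<close> and \<open>x\<close> have to be avoided by \<open>B/A\<close>:
  the boundary values of its argument on the negative axis then give the interlacing.\<close>
lemma interlacesI:
  assumes A: "nonneg_coeffs A" "zero_free A" "A \<noteq> 0" and B: "nonneg_coeffs B" "zero_free B" "B \<noteq> 0"
    and neg: "\<And>x t. Im x > 0 \<Longrightarrow> t > 0 \<Longrightarrow> ceval B x * cnj (ceval A x) \<noteq> - of_real t"
    and negx: "\<And>x t. Im x > 0 \<Longrightarrow> t > 0 \<Longrightarrow> ceval B x * cnj (ceval A x) \<noteq> - of_real t * x"
  shows "A \<prec> B"
proof -
  have 1: "cis (Ang x (proots B) - Ang x (proots A)) \<noteq> -1" if x: "Im x > 0" for x
  proof
    obtain R where R: "R > 0" "ceval B x * cnj (ceval A x) = of_real R * cis (Ang x (proots B) - Ang x (proots A))"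
      using phase_polar[OF A B x] by blast
    assume "cis (Ang x (proots B) - Ang x (proots A)) = -1"
    with R neg[OF x R(1)] show False
      by simp
  qed
  have 2: "cis (Ang x (proots B) - Ang x (proots A) - ang x 0) \<noteq> -1" if x: "Im x > 0" for x
  proof
    let ?f = "Ang x (proots B) - Ang x (proots A)"
    obtain R where R: "R > 0" "ceval B x * cnj (ceval A x) = of_real R * cis ?f"
      using phase_polar[OF A B x] by blast
    have nx: "norm x > 0"
      using x by auto
    have xe: "of_real (norm x) * cis (ang x 0) = x"
      using diff_eq_cis_ang[OF x, of 0] by simp
    assume "cis (?f - ang x 0) = -1"
    moreover have "cis ?f = cis (?f - ang x 0) * cis (ang x 0)"
      by (simp add: cis_mult)
    ultimately have "cis ?f = - cis (ang x 0)"
      by simp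
    then have "ceval B x * cnj (ceval A x) = - of_real (R / norm x) * (of_real (norm x) * cis (ang x 0))"
      using R(2) nx by simp
    then have "ceval B x * cnj (ceval A x) = - of_real (R / norm x) * x"
      by (simp only: xe)
    moreover have "R / norm x > 0"
      using R(1) nx by simp
    ultimately show False
      using negx[OF x] by blast
  qed
  note bounds = above_bounds[OF proots_nonpos[OF A(1,3)] proots_nonpos[OF B(1,3)] 1 2]
  show ?thesis
    unfolding interlaces_iff[OF A(2,3) B(2,3)]
    by (rule interlacing_listsI) (simp_all only: mset_sorted_list_of_multiset sorted_sorted_list_of_multiset bounds)
qed

section \<open>Interpolatory squares\<close>


lemma cone_0 [simp]: "cone x 0"
  by (simp add: cone_def)

lemma cone_add: "cone x a \<Longrightarrow> cone x b \<Longrightarrow> cone x (a + b)"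
  by (simp add: cone_def algebra_simps)

lemma cone_scale: "r \<ge> 0 \<Longrightarrow> cone x c \<Longrightarrow> cone x (of_real r * c)"
proof -
  assume r: "r \<ge> 0" and "cone x c"
  then have "r * Im c \<ge> 0" "r * Im (x * cnj c) \<ge> 0"
    by (simp_all add: cone_def)
  moreover have "Im (x * cnj (of_real r * c)) = r * Im (x * cnj c)"
    by (simp add: algebra_simps)
  ultimately show ?thesis
    by (simp add: cone_def del: mult_minus_left mult_minus_right)
qed

lemma cone_scale_iff: "r > 0 \<Longrightarrow> cone x (of_real r * c) \<longleftrightarrow> cone x c"
proof
  assume r: "r > 0" and "cone x (of_real r * c)"
  then have "cone x (of_real (1 / r) * (of_real r * c))"
    by (intro cone_scale[of "1 / r"]) auto
  with r show "cone x c"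
    by simp
qed (simp add: cone_scale)

lemma cone_norm: "cone x c \<Longrightarrow> cone x (z * cnj z * c)"
  using cone_scale[of "(norm z)\<^sup>2" x c] by (simp add: complex_norm_square[symmetric])

text \<open>For \<open>x\<close> in the upper half plane, \<open>c \<mapsto> x * cnj c\<close> is,
  up to a positive factor, the reflection of the cone that exchanges the rays through
  \<open>1\<close> and \<open>x\<close>.\<close>

lemma cone_cnj: "cone x c \<Longrightarrow> cone x (x * cnj c)"
  using mult_nonneg_nonneg[of "(norm x)\<^sup>2" "Im c"]
  by (auto simp: cone_def cmod_power2 power2_eq_square algebra_simps)

lemma cone_pointed:
  assumes "Im x > 0" "cone x c" "cone x (- c)"
  shows "c = 0"
proof -
  from assms have "Im c = 0" "Im (x * cnj c) = 0"
    by (auto simp: cone_def)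
  with assms(1) show ?thesis
    by (simp add: complex_eq_iff)
qed

lemma cone_iff:
  assumes "Im x > 0"
  shows "cone x c \<longleftrightarrow> (\<exists>s\<ge>0. \<exists>t\<ge>0. c = of_real s + of_real t * x)"
proof
  assume c: "cone x c"
  define t where "t = Im c / Im x"
  define s where "s = Im (x * cnj c) / Im x"
  have "s \<ge> 0" "t \<ge> 0"
    using c assms unfolding cone_def s_def t_def by (blast intro: divide_nonneg_pos)+
  moreover have "c = of_real s + of_real t * x"
    using assms by (simp add: complex_eq_iff s_def t_def field_simps)
  ultimately show "\<exists>s\<ge>0. \<exists>t\<ge>0. c = of_real s + of_real t * x"
    by blast
next
  assume "\<exists>s\<ge>0. \<exists>t\<ge>0. c = of_real s + of_real t * x"
  then obtain s t where "s \<ge> 0" "t \<ge> 0" "c = of_real s + of_real t * x"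
    by blast
  moreover from this have "Im (x * cnj c) = s * Im x"
    by (simp add: algebra_simps)
  ultimately show "cone x c"
    using assms by (simp add: cone_def)
qed

lemma cone_of_real: "Im x > 0 \<Longrightarrow> r \<ge> 0 \<Longrightarrow> cone x (of_real r)"
  and cone_of_real_mult: "Im x > 0 \<Longrightarrow> r \<ge> 0 \<Longrightarrow> cone x (of_real r * x)"
  by (auto simp: cone_def)

text \<open>The cone is closed: let \<open>t \<rightarrow> 0\<close>, and let
  \<open>t \<rightarrow> \<infinity>\<close> after division by \<open>t\<^sup>2\<close>.\<close>

lemma cone_limits:
  assumes "\<And>t. t > 0 \<Longrightarrow> cone x (a + of_real t * b + of_real (t\<^sup>2) * c)"
  shows "cone x a" "cone x c"
proof -
  have q: "\<alpha> \<ge> 0" if *: "\<And>t. t > 0 \<Longrightarrow> \<alpha> + t * \<beta> + t\<^sup>2 * \<gamma> \<ge> 0" for \<alpha> \<beta> \<gamma> :: real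
  proof -
    have "((\<lambda>t. \<alpha> + t * \<beta> + t\<^sup>2 * \<gamma>) \<longlongrightarrow> \<alpha> + 0 * \<beta> + 0\<^sup>2 * \<gamma>) (at_right 0)"
      by (intro tendsto_intros)
    moreover have "\<forall>\<^sub>F t in at_right 0. \<alpha> + t * \<beta> + t\<^sup>2 * \<gamma> \<ge> 0"
      using eventually_at_right_less[of "0::real"] by eventually_elim (rule *)
    ultimately show ?thesis
      by (auto dest: tendsto_lowerbound simp: trivial_limit_at_right_real)
  qed
  have q': "\<gamma> \<ge> 0" if *: "\<And>t. t > 0 \<Longrightarrow> \<alpha> + t * \<beta> + t\<^sup>2 * \<gamma> \<ge> 0" for \<alpha> \<beta> \<gamma> :: real
  proof (rule q[of _ \<beta> \<alpha>])
    fix t :: real assume t: "t > 0"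
    have "\<gamma> + t * \<beta> + t\<^sup>2 * \<alpha> = t\<^sup>2 * (\<alpha> + (1 / t) * \<beta> + (1 / t)\<^sup>2 * \<gamma>)"
      using t by (simp add: field_simps power2_eq_square)
    with *[of "1 / t"] t show "\<gamma> + t * \<beta> + t\<^sup>2 * \<alpha> \<ge> 0"
      by simp
  qed
  have 1: "Im a + t * Im b + t\<^sup>2 * Im c \<ge> 0" if "t > 0" for t
    using assms[OF that] by (simp add: cone_def)
  have 2: "Im (x * cnj a) + t * Im (x * cnj b) + t\<^sup>2 * Im (x * cnj c) \<ge> 0" if "t > 0" for t
    using assms[OF that] by (simp add: cone_def algebra_simps)
  show "cone x a" "cone x c"
    unfolding cone_def using q[OF 1] q[OF 2] q'[OF 1] q'[OF 2] by blast+
qed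

lemma interp_cube1_iff:
  "interp_cube1 A B \<longleftrightarrow> (A = 0 \<or> nonneg_coeffs A \<and> zero_free A) \<and> (B = 0 \<or> nonneg_coeffs B \<and> zero_free B)
     \<and> (\<forall>x. Im x > 0 \<longrightarrow> cone x (ceval B x * cnj (ceval A x)))"
proof -
  have "A \<prec> B \<longleftrightarrow> (\<forall>x. Im x > 0 \<longrightarrow> cone x (ceval B x * cnj (ceval A x)))"
    if AB: "A = 0 \<or> nonneg_coeffs A \<and> zero_free A" "B = 0 \<or> nonneg_coeffs B \<and> zero_free B"
  proof (cases "A = 0 \<or> B = 0")
    case True
    with AB show ?thesis
      by (auto simp: interlaces_def only_real_zeros_iff)
  next
    case False
    have "\<not> cone x (- of_real t)" "\<not> cone x (- of_real t * x)" if "Im x > 0" "t > 0" for x t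
    proof -
      have 1: "cone x (of_real t)" and 2: "cone x (of_real t * x)"
        using that cone_of_real[of x t] cone_of_real_mult[of x t] by auto
      show "\<not> cone x (- of_real t)"
        using cone_pointed[OF that(1) 1] that by auto
      show "\<not> cone x (- of_real t * x)"
        using cone_pointed[OF that(1) 2] that by auto
    qed
    then have "A \<prec> B" if "\<And>x. Im x > 0 \<Longrightarrow> cone x (ceval B x * cnj (ceval A x))"
      using that False AB by (intro interlacesI) metis+
    then show ?thesis
      using interlaces_imp_cone False AB by blast
  qed
  then show ?thesis
    unfolding interp_cube1_def using standard_nonpos_zeros_iff by metis
qed

text \<open>If \<open>B / A\<close> took a value \<open>- s\<close> or \<open>- s * x\<close> with
  \<open>s > 0\<close> at \<open>x\<close>, a positive combination of the first or of the second
  kind would vanish there; these are exactly the rays that \<open>interlacesI\<close> excludes.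
  Limits handle \<open>A\<close> and \<open>B\<close> themselves.\<close>

lemma interp_cube1_from_rays:
  assumes 1: "\<And>lam rho. lam > 0 \<Longrightarrow> rho > 0 \<Longrightarrow>
      smult lam A + smult rho B = 0 \<or> nonneg_coeffs (smult lam A + smult rho B) \<and> zero_free (smult lam A + smult rho B)"
    and 2: "\<And>lam rho. lam > 0 \<Longrightarrow> rho > 0 \<Longrightarrow>
      smult lam B + smult rho ([:0, 1:] * A) = 0 \<or>
      nonneg_coeffs (smult lam B + smult rho ([:0, 1:] * A)) \<and> zero_free (smult lam B + smult rho ([:0, 1:] * A))"
  shows "interp_cube1 A B"
proof -
  have n: "nonneg_coeffs A" "nonneg_coeffs B"
    using 1[of 1] nonneg_coeffs_limits[of A B] by (metis nonneg_coeffs_0 smult_1_left zero_less_one)+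
  have zA: "zero_free A" if "A \<noteq> 0"
  proof (rule zero_free_limit[OF _ that])
    fix t :: real assume t: "t > 0"
    have "A + smult t B \<noteq> 0"
      using nonneg_coeffs_add_eq_0[of A "smult t B"] n t that by (simp add: nonneg_coeffs_smult)
    with 1[of 1 t] t show "nonneg_coeffs (A + smult t B) \<and> zero_free (A + smult t B)"
      by simp
  qed
  have zB: "zero_free B" if "B \<noteq> 0"
  proof (rule zero_free_limit[OF _ that])
    fix t :: real assume t: "t > 0"
    have "B + smult t A \<noteq> 0"
      using nonneg_coeffs_add_eq_0[of B "smult t A"] n t that by (simp add: nonneg_coeffs_smult)
    with 1[of t 1] t show "nonneg_coeffs (B + smult t A) \<and> zero_free (B + smult t A)"
      by (simp add: add.commute)
  qed
  have "A \<prec> B"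
  proof (cases "A = 0 \<or> B = 0")
    case True
    then show ?thesis
      using zA zB by (auto simp: interlaces_def only_real_zeros_iff)
  next
    case False
    then have nz: "A \<noteq> 0" "B \<noteq> 0"
      by auto
    have nA: "ceval A x \<noteq> 0" if "Im x > 0" for x
      using zA[OF nz(1)] that by (auto simp: zero_free_def)
    show ?thesis
    proof (rule interlacesI)
      fix x :: complex and t :: real assume x: "Im x > 0" and t: "t > 0"
      \<comment> \<open>Clears the denominator: multiplying \<open>B * cnj A = - t\<close> by
        \<open>A\<close> gives \<open>t * A + m * B = 0\<close>.\<close>
      define m where "m = (norm (ceval A x))\<^sup>2"
      have m: "m > 0" "of_real m = ceval A x * cnj (ceval A x)"
        using nA[OF x] by (simp_all add: m_def complex_norm_square[symmetric])
      show "ceval B x * cnj (ceval A x) \<noteq> - of_real t"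
      proof
        assume "ceval B x * cnj (ceval A x) = - of_real t"
        then have "ceval (smult t A + smult m B) x = 0"
          by (simp add: m) algebra
        moreover have "smult t A + smult m B \<noteq> 0"
          using nonneg_coeffs_add_eq_0[of "smult t A" "smult m B"] n t m nz by (simp add: nonneg_coeffs_smult)
        ultimately show False
          using 1[OF t m(1)] x by (auto simp: zero_free_def)
      qed
      show "ceval B x * cnj (ceval A x) \<noteq> - of_real t * x"
      proof
        assume "ceval B x * cnj (ceval A x) = - of_real t * x"
        then have "ceval (smult m B + smult t ([:0, 1:] * A)) x = 0"
          by (simp add: m) algebra
        moreover have "smult m B + smult t ([:0, 1:] * A) \<noteq> 0"
          using nonneg_coeffs_add_eq_0[of "smult m B" "smult t ([:0, 1:] * A)"] n t m nz
          by (simp add: nonneg_coeffs_smult)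
        ultimately show False
          using 2[OF m(1) t] x by (auto simp: zero_free_def simp del: mult_pCons_left)
      qed
    qed (use nz n zA zB in auto)
  qed
  then show ?thesis
    unfolding interp_cube1_def using standard_nonpos_zeros_iff n zA zB by metis
qed

section \<open>Even and odd parts, stability and the square relation\<close>

lemma coeff_even_part [simp]: "coeff (even_part p) i = coeff p (2 * i)"
  by (auto simp: even_part_def nth_default_def coeff_eq_0 simp del: upt_Suc)

lemma coeff_odd_part [simp]: "coeff (odd_part p) i = coeff p (2 * i + 1)"
  by (auto simp: odd_part_def nth_default_def coeff_eq_0 simp del: upt_Suc)

lemma even_part_add [simp]: "even_part (p + q) = even_part p + even_part q"
  and odd_part_add [simp]: "odd_part (p + q) = odd_part p + odd_part q"
  and even_part_smult [simp]: "even_part (smult a p) = smult a (even_part p)"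
  and odd_part_smult [simp]: "odd_part (smult a p) = smult a (odd_part p)"
  and even_part_0 [simp]: "even_part 0 = 0"
  and odd_part_0 [simp]: "odd_part 0 = 0"
  by (simp_all add: poly_eq_iff)

lemma even_part_pCons [simp]: "even_part (pCons a p) = pCons a (odd_part p)"
  by (simp add: poly_eq_iff coeff_pCons split: nat.split)

lemma odd_part_pCons [simp]: "odd_part (pCons a p) = even_part p"
  by (simp add: poly_eq_iff)

lemma parts_eq_0_iff: "even_part p = 0 \<and> odd_part p = 0 \<longleftrightarrow> p = 0"
proof
  assume *: "even_part p = 0 \<and> odd_part p = 0"
  show "p = 0"
  proof (rule poly_eqI)
    fix n
    from * have "coeff (even_part p) (n div 2) = 0" "coeff (odd_part p) (n div 2) = 0"
      by simp_all
    then show "coeff p n = coeff 0 n"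
      by (cases "even n") (auto elim: evenE oddE)
  qed
qed simp

lemma nonneg_coeffs_parts_iff:
  "nonneg_coeffs p \<longleftrightarrow> nonneg_coeffs (even_part p) \<and> nonneg_coeffs (odd_part p)"
proof
  assume *: "nonneg_coeffs (even_part p) \<and> nonneg_coeffs (odd_part p)"
  have "coeff p n \<ge> 0" for n
  proof -
    from * have "coeff (even_part p) (n div 2) \<ge> 0" "coeff (odd_part p) (n div 2) \<ge> 0"
      unfolding nonneg_coeffs_def by blast+
    then show ?thesis
      by (cases "even n") (auto elim: evenE oddE)
  qed
  then show "nonneg_coeffs p"
    by (simp add: nonneg_coeffs_def)
qed (simp add: nonneg_coeffs_def)

lemma even_part_mult: "even_part (p * q) = even_part p * even_part q + [:0, 1:] * (odd_part p * odd_part q)"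
  and odd_part_mult: "odd_part (p * q) = even_part p * odd_part q + odd_part p * even_part q"
  by (induction p) (simp_all add: algebra_simps)

abbreviation Ev :: "real poly \<Rightarrow> complex \<Rightarrow> complex" where "Ev p \<equiv> ceval (even_part p)"
abbreviation Od :: "real poly \<Rightarrow> complex \<Rightarrow> complex" where "Od p \<equiv> ceval (odd_part p)"

text \<open>With \<open>x = u\<^sup>2\<close> and \<open>p(u) = Ev + u Od\<close>, this is the odd part of \<open>(a + b u) p(u)\<close>
  and, for \<open>(b x, a)\<close> in place of \<open>(a, b)\<close>, the even part.\<close>
definition lin :: "complex \<Rightarrow> complex \<Rightarrow> complex \<Rightarrow> real poly \<Rightarrow> complex" where
  "lin x a b p = b * Ev p x + a * Od p x"

text \<open>By the Hermite-Biehler theorem these are 0 and the polynomials with positive leading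
  coefficient whose zeros all lie in the closed left half plane. The pointwise form makes closure
  under products a computation in the cone.\<close>

definition hurwitz :: "real poly \<Rightarrow> bool" where
  "hurwitz p \<longleftrightarrow> nonneg_coeffs p \<and>
     (\<forall>x. Im x > 0 \<longrightarrow> cone x (Ev p x * cnj (Od p x)) \<and> (p \<noteq> 0 \<longrightarrow> Ev p x \<noteq> 0 \<or> Od p x \<noteq> 0))"

text \<open>\<open>lin x a b K\<close> and \<open>lin x (b * x) a J\<close> are the odd parts of
  \<open>(a + b u) K\<close> and \<open>(a + b u) u J\<close>. The even parts are covered as well:
  they arise on replacing \<open>(a, b)\<close> by \<open>(b * x, a)\<close>, and
  \<open>cone_cnj\<close> preserves the hypothesis.\<close>

definition square_rel :: "real poly \<Rightarrow> real poly \<Rightarrow> bool" where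
  "square_rel K J \<longleftrightarrow>
     (\<forall>x a b. Im x > 0 \<longrightarrow> cone x (a * cnj b) \<longrightarrow> cone x (lin x (b * x) a J * cnj (lin x a b K)))"

text \<open>Both multipliers are required to be nonzero, as one of the two parts of a nonzero
  \<open>p\<close> may be identically zero.\<close>

definition nonvanishing :: "real poly \<Rightarrow> bool" where
  "nonvanishing p \<longleftrightarrow> (\<forall>x a b. Im x > 0 \<longrightarrow> cone x (a * cnj b) \<longrightarrow> a \<noteq> 0 \<longrightarrow> b \<noteq> 0 \<longrightarrow> p \<noteq> 0 \<longrightarrow> lin x a b p \<noteq> 0)"

text \<open>Multiplying \<open>b * f = - a * g\<close> by \<open>cnj b * cnj g\<close> exhibits one
  element of the cone as the negative of another.\<close>

lemma cone_sum_eq_0: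
  assumes "Im x > 0" "cone x (a * cnj b)" "cone x (f * cnj g)" "b * f + a * g = 0"
  shows "b * f = 0" "a * g = 0"
proof -
  have "cone x (b * cnj b * (f * cnj g))" "cone x (g * cnj g * (a * cnj b))"
    using assms by (auto intro: cone_norm)
  moreover have "g * cnj g * (a * cnj b) = - (b * cnj b * (f * cnj g))"
    using assms(4) by algebra
  ultimately have "b * cnj b * (f * cnj g) = 0"
    using cone_pointed[OF assms(1)] by metis
  then show "b * f = 0" "a * g = 0"
    using assms(4) by auto
qed

text \<open>The even part of \<open>(a + b u) (f + g u)\<close> against its odd part: the product
  expands into four elements of the cone, two of them reflected.\<close>

lemma cone_mult:
  assumes "cone x (a * cnj b)" "cone x (f * cnj g)"
  shows "cone x ((b * x * g + a * f) * cnj (b * f + a * g))"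
proof -
  have "(b * x * g + a * f) * cnj (b * f + a * g)
      = b * cnj b * (x * cnj (f * cnj g)) + g * cnj g * (x * cnj (a * cnj b))
      + f * cnj f * (a * cnj b) + a * cnj a * (f * cnj g)"
    by (simp add: algebra_simps)
  then show ?thesis
    using assms by (simp only:) (intro cone_add cone_norm cone_cnj)
qed

lemma hurwitz_nonvanishing: "hurwitz p \<Longrightarrow> nonvanishing p"
  unfolding nonvanishing_def lin_def hurwitz_def using cone_sum_eq_0 by (metis mult_eq_0_iff)

lemma lin_mult: "lin x a b (h * p) = lin x (lin x (b * x) a h) (lin x a b h) p"
  by (simp add: lin_def even_part_mult odd_part_mult algebra_simps)

lemma lin_add [simp]: "lin x a b (p + q) = lin x a b p + lin x a b q"
  by (simp add: lin_def algebra_simps)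

lemma hurwitz_mult:
  assumes "hurwitz p" "hurwitz q"
  shows "hurwitz (p * q)"
  unfolding hurwitz_def
proof (intro conjI allI impI)
  show "nonneg_coeffs (p * q)"
    using assms by (simp add: hurwitz_def nonneg_coeffs_mult)
next
  fix x :: complex assume x: "Im x > 0"
  let ?a = "Ev p x" and ?b = "Od p x" and ?f = "Ev q x" and ?g = "Od q x"
  have c: "cone x (?a * cnj ?b)" "cone x (?f * cnj ?g)"
    using assms x by (auto simp: hurwitz_def)
  show "cone x (Ev (p * q) x * cnj (Od (p * q) x))"
    using cone_mult[OF c] by (simp add: even_part_mult odd_part_mult algebra_simps)
  assume nz: "p * q \<noteq> 0"
  show "Ev (p * q) x \<noteq> 0 \<or> Od (p * q) x \<noteq> 0"
  proof (rule ccontr)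
    assume "\<not> ?thesis"
    then have "?a * ?f + (x * ?b) * ?g = 0" "?b * ?f + ?a * ?g = 0"
      by (simp_all add: even_part_mult odd_part_mult algebra_simps)
    moreover have "cone x (x * ?b * cnj ?a)"
      using cone_cnj[OF c(1)] by (simp add: mult_ac)
    ultimately have "?a * ?f = 0" "x * ?b * ?g = 0" "?b * ?f = 0" "?a * ?g = 0"
      using cone_sum_eq_0[OF x] c by blast+
    moreover have "x \<noteq> 0" "?a \<noteq> 0 \<or> ?b \<noteq> 0" "?f \<noteq> 0 \<or> ?g \<noteq> 0"
      using x nz assms by (auto simp: hurwitz_def)
    ultimately show False
      by auto
  qed
qed

text \<open>Multiplying by \<open>h\<close> turns the multiplier \<open>a + b u\<close> into
  \<open>(a + b u) h\<close>; by \<open>cone_mult\<close> its even and odd parts are again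
  admissible.\<close>

lemma square_rel_mult:
  assumes "hurwitz h" "square_rel K J"
  shows "square_rel (h * K) (h * J)"
  unfolding square_rel_def
proof (intro allI impI)
  fix x a b assume x: "Im x > 0" and ab: "cone x (a * cnj b)"
  have "cone x (lin x (b * x) a h * cnj (lin x a b h))"
    using cone_mult[OF ab, of "Ev h x" "Od h x"] assms(1) x by (simp add: hurwitz_def lin_def add.commute)
  with assms(2) x have "cone x (lin x (lin x a b h * x) (lin x (b * x) a h) J
      * cnj (lin x (lin x (b * x) a h) (lin x a b h) K))"
    by (simp add: square_rel_def)
  moreover have "lin x (b * x) a (h * J) = lin x (lin x a b h * x) (lin x (b * x) a h) J"
    by (simp add: lin_def even_part_mult odd_part_mult algebra_simps)
  ultimately show "cone x (lin x (b * x) a (h * J) * cnj (lin x a b (h * K)))"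
    by (simp add: lin_mult)
qed

text \<open>The hypothesis at \<open>(b * x, a)\<close> in place of \<open>(a, b)\<close> is the
  reversed relation, up to the reflection of \<open>cone_cnj\<close>.\<close>

lemma square_rel_sym:
  assumes "square_rel K J"
  shows "square_rel J K"
  unfolding square_rel_def
proof (intro allI impI)
  fix x a b assume x: "Im x > 0" and ab: "cone x (a * cnj b)"
  have "cone x (b * x * cnj a)"
    using cone_cnj[OF ab] by (simp add: mult_ac)
  with assms x have "cone x (lin x (a * x) (b * x) J * cnj (lin x (b * x) a K))"
    by (simp add: square_rel_def)
  moreover have "lin x (a * x) (b * x) J = x * lin x a b J"
    by (simp add: lin_def algebra_simps)
  ultimately have "cone x (x * cnj (x * lin x a b J * cnj (lin x (b * x) a K)))"
    by (intro cone_cnj) simp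
  moreover have "x * cnj (x * lin x a b J * cnj (lin x (b * x) a K))
      = of_real ((norm x)\<^sup>2) * (lin x (b * x) a K * cnj (lin x a b J))"
    by (simp only: complex_norm_square) (simp add: mult_ac)
  moreover have "(norm x)\<^sup>2 > 0"
    using x by auto
  ultimately show "cone x (lin x (b * x) a K * cnj (lin x a b J))"
    by (simp only: cone_scale_iff)
qed

lemma square_rel_add_right: "square_rel K J \<Longrightarrow> square_rel K J' \<Longrightarrow> square_rel K (J + J')"
  and square_rel_add_left: "square_rel K J \<Longrightarrow> square_rel K' J \<Longrightarrow> square_rel (K + K') J"
  by (simp_all add: square_rel_def distrib_left distrib_right cone_add)

text \<open>Where the values of \<open>p\<close> and \<open>q\<close> cancel, the cone contains two
  opposite elements, both with the value of \<open>w\<close> as a factor. The cone is pointed and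
  that factor is nonzero, so the two values vanish separately.\<close>

lemma nonvanishing_add:
  assumes "hurwitz p" "hurwitz q" "hurwitz w" "w \<noteq> 0" "square_rel p w" "square_rel q w"
  shows "nonvanishing (p + q)"
  unfolding nonvanishing_def
proof (intro allI impI notI)
  fix x a b
  assume x: "Im x > 0" and ab: "cone x (a * cnj b)" and nz: "a \<noteq> 0" "b \<noteq> 0" "p + q \<noteq> 0"
    and 0: "lin x a b (p + q) = 0"
  let ?w = "lin x (b * x) a w"
  have "cone x (b * x * cnj a)"
    using cone_cnj[OF ab] by (simp add: mult_ac)
  moreover have "b * x \<noteq> 0"
    using x nz by auto
  ultimately have w: "?w \<noteq> 0"
    using hurwitz_nonvanishing[OF assms(3)] assms(4) x nz unfolding nonvanishing_def by blast
  have "cone x (?w * cnj (lin x a b p))" "cone x (?w * cnj (lin x a b q))"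
    using assms x ab by (auto simp: square_rel_def)
  moreover have "lin x a b q = - lin x a b p"
    using 0 by (simp add: add_eq_0_iff)
  ultimately have "?w * cnj (lin x a b p) = 0"
    by (intro cone_pointed[OF x]) simp_all
  with w have "lin x a b p = 0"
    by simp
  moreover from this 0 have "lin x a b q = 0"
    by simp
  ultimately have "p = 0" "q = 0"
    using hurwitz_nonvanishing[OF assms(1)] hurwitz_nonvanishing[OF assms(2)] x ab nz
    unfolding nonvanishing_def by blast+
  with nz show False
    by simp
qed

definition hsquare :: "real poly \<Rightarrow> real poly \<Rightarrow> bool" where
  "hsquare K J \<longleftrightarrow> interp_square (odd_part K) (even_part K) (even_part J) ([:0, 1:] * odd_part J)"

lemma hsquareI:
  assumes n: "nonneg_coeffs K" "nonneg_coeffs J" and nv: "nonvanishing K" "nonvanishing J" and S: "square_rel K J"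
  shows "hsquare K J"
  unfolding hsquare_def interp_square_def
proof (intro allI impI)
  fix lam rho :: real assume pos: "lam > 0" "rho > 0"
  have n': "nonneg_coeffs (even_part K)" "nonneg_coeffs (odd_part K)" "nonneg_coeffs (even_part J)" "nonneg_coeffs (odd_part J)"
    using n unfolding nonneg_coeffs_parts_iff[of K] nonneg_coeffs_parts_iff[of J] by blast+
  \<comment> \<open>The two cubes of the square belong to the multipliers \<open>(lam, rho)\<close>
    and \<open>(rho * x, lam)\<close>, that is, to the odd and even parts for
    \<open>lam + rho u\<close>.\<close>
  have c1: "cone x (of_real lam * cnj (of_real rho))" if "Im x > 0" for x
    using that pos cone_of_real[of x "lam * rho"] by simp
  have c2: "cone x (of_real rho * x * cnj (of_real lam))" if "Im x > 0" for x
    using that pos cone_of_real_mult[of x "rho * lam"] by (simp add: mult_ac)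
  have l1: "lin x lam rho p \<noteq> 0" and l2: "lin x (rho * x) lam p \<noteq> 0"
    if "nonvanishing p" "p \<noteq> 0" "Im x > 0" for x :: complex and p
  proof -
    have "of_real rho * x \<noteq> 0"
      using that pos by auto
    then show "lin x lam rho p \<noteq> 0" "lin x (rho * x) lam p \<noteq> 0"
      using that pos c1 c2 unfolding nonvanishing_def by auto
  qed
  have g: "P = 0 \<or> nonneg_coeffs P \<and> zero_free P"
    if "nonneg_coeffs P" "p = 0 \<Longrightarrow> P = 0" "\<And>x. p \<noteq> 0 \<Longrightarrow> Im x > 0 \<Longrightarrow> ceval P x \<noteq> 0" for P p :: "real poly"
    using that by (cases "p = 0") (auto simp: zero_free_def)
  show "interp_cube1 (smult lam (odd_part K) + smult rho (even_part K))
            (smult lam (even_part J) + smult rho ([:0, 1:] * odd_part J)) \<and>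
        interp_cube1 (smult lam (even_part K) + smult rho ([:0, 1:] * odd_part K))
            (smult lam ([:0, 1:] * odd_part J) + smult rho ([:0, 1:] * even_part J))"
    unfolding interp_cube1_iff
  proof (intro conjI allI impI)
    show "smult lam (odd_part K) + smult rho (even_part K) = 0 \<or> nonneg_coeffs (smult lam (odd_part K) + smult rho (even_part K)) \<and> zero_free (smult lam (odd_part K) + smult rho (even_part K))"
    proof (rule g[of _ K])
      fix x assume "K \<noteq> 0" "Im x > 0"
      then have "lin x lam rho K \<noteq> 0"
        by (intro l1 nv(1))
      then show "ceval (smult lam (odd_part K) + smult rho (even_part K)) x \<noteq> 0"
        by (simp add: lin_def algebra_simps)
    qed (use n' pos in \<open>auto intro!: nonneg_coeffs_add nonneg_coeffs_smult\<close>)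
    show "smult lam (even_part J) + smult rho ([:0, 1:] * odd_part J) = 0 \<or> nonneg_coeffs (smult lam (even_part J) + smult rho ([:0, 1:] * odd_part J)) \<and> zero_free (smult lam (even_part J) + smult rho ([:0, 1:] * odd_part J))"
    proof (rule g[of _ J])
      fix x assume "J \<noteq> 0" "Im x > 0"
      then have "lin x (rho * x) lam J \<noteq> 0"
        by (intro l2 nv(2))
      then show "ceval (smult lam (even_part J) + smult rho ([:0, 1:] * odd_part J)) x \<noteq> 0"
        by (simp add: lin_def algebra_simps)
    qed (use n' pos in \<open>auto intro!: nonneg_coeffs_add nonneg_coeffs_smult\<close>)
    show "smult lam (even_part K) + smult rho ([:0, 1:] * odd_part K) = 0 \<or> nonneg_coeffs (smult lam (even_part K) + smult rho ([:0, 1:] * odd_part K)) \<and> zero_free (smult lam (even_part K) + smult rho ([:0, 1:] * odd_part K))"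
    proof (rule g[of _ K])
      fix x assume "K \<noteq> 0" "Im x > 0"
      then have "lin x (rho * x) lam K \<noteq> 0"
        by (intro l2 nv(1))
      then show "ceval (smult lam (even_part K) + smult rho ([:0, 1:] * odd_part K)) x \<noteq> 0"
        by (simp add: lin_def algebra_simps)
    qed (use n' pos in \<open>auto intro!: nonneg_coeffs_add nonneg_coeffs_smult\<close>)
    show "smult lam ([:0, 1:] * odd_part J) + smult rho ([:0, 1:] * even_part J) = 0 \<or> nonneg_coeffs (smult lam ([:0, 1:] * odd_part J) + smult rho ([:0, 1:] * even_part J)) \<and> zero_free (smult lam ([:0, 1:] * odd_part J) + smult rho ([:0, 1:] * even_part J))"
    proof (rule g[of _ J])
      fix x assume "J \<noteq> 0" "Im x > 0"
      \<comment> \<open>The even part of \<open>(lam + rho u) u J\<close> is \<open>x\<close> times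
        the odd part of \<open>(lam + rho u) J\<close>.\<close>
      then have "x * lin x lam rho J \<noteq> 0"
        using l1[OF nv(2)] by auto
      then show "ceval (smult lam ([:0, 1:] * odd_part J) + smult rho ([:0, 1:] * even_part J)) x \<noteq> 0"
        by (simp add: lin_def algebra_simps)
    qed (use n' pos in \<open>auto intro!: nonneg_coeffs_add nonneg_coeffs_smult\<close>)
  next
    fix x assume x: "Im x > 0"
    show "cone x (ceval (smult lam (even_part J) + smult rho ([:0, 1:] * odd_part J)) x
        * cnj (ceval (smult lam (odd_part K) + smult rho (even_part K)) x))"
      using S[unfolded square_rel_def, rule_format, OF x c1[OF x]] by (simp add: lin_def algebra_simps)
    show "cone x (ceval (smult lam ([:0, 1:] * odd_part J) + smult rho ([:0, 1:] * even_part J)) x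
        * cnj (ceval (smult lam (even_part K) + smult rho ([:0, 1:] * odd_part K)) x))"
      using S[unfolded square_rel_def, rule_format, OF x c2[OF x]] by (simp add: lin_def algebra_simps)
  qed
qed

section \<open>From positive real to complex multipliers\<close>

text \<open>\<open>z \<mapsto> (c + z d) / (a + z)\<close> has its pole \<open>-a\<close> outside the cone. Along the ray from \<open>-a\<close> through \<open>z\<close>
  its value at \<open>z\<close> is a convex combination of the value where the ray enters the cone and the value \<open>d\<close> at infinity.\<close>
lemma cone_fractional_linear:
  assumes x: "Im x > 0" and a: "cone x a" and z: "cone x z" and d: "cone x d"
    and r1: "\<And>t. t \<ge> 0 \<Longrightarrow> cone x ((c + of_real t * d) * cnj (a + of_real t))"
    and rx: "\<And>t. t \<ge> 0 \<Longrightarrow> cone x ((c + of_real t * x * d) * cnj (a + of_real t * x))"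
  shows "cone x ((c + z * d) * cnj (a + z))"
proof -
  obtain a1 a2 where a12: "a1 \<ge> 0" "a2 \<ge> 0" "a = of_real a1 + of_real a2 * x"
    using a cone_iff[OF x] by blast
  obtain s t where st: "s \<ge> 0" "t \<ge> 0" "z = of_real s + of_real t * x"
    using z cone_iff[OF x] by blast
  \<comment> \<open>\<open>s = 0\<close> or \<open>t = 0\<close> puts \<open>z\<close> on a boundary
    ray, and \<open>a = 0\<close> puts the pole at the apex.\<close>
  consider "s = 0" | "t = 0" | "a = 0" | "s > 0" "t > 0" "a \<noteq> 0"
    using st by force
  then show ?thesis
  proof cases
    case 1
    with rx[of t] st show ?thesis
      by simp
  next
    case 2
    with r1[of s] st show ?thesis
      by simp
  next
    case 3
    have "cone x (c + of_real u * d + of_real (u\<^sup>2) * 0)" if "u > 0" for u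
    proof -
      have "cone x (of_real u * (c + of_real u * d))"
        using r1[of u] 3 that by (simp add: mult_ac)
      then show ?thesis
        using that by (simp add: cone_scale_iff)
    qed
    from cone_limits(1)[OF this] have c1: "cone x c" .
    have "cone x (c * cnj x + of_real u * (x * cnj x * d) + of_real (u\<^sup>2) * 0)" if "u > 0" for u
    proof -
      have "cone x (of_real u * (c * cnj x + of_real u * (x * cnj x * d)))"
        using rx[of u] 3 that by (simp add: algebra_simps)
      then show ?thesis
        using that by (simp add: cone_scale_iff)
    qed
    from cone_limits(1)[OF this] have cx: "cone x (c * cnj x)" .
    have "(c + z * d) * cnj (a + z) = of_real s * c + of_real t * (c * cnj x) + z * cnj z * d"
      using 3 st by (simp add: algebra_simps)
    then show ?thesis
      using c1 cx d st by (simp only:) (intro cone_add cone_scale cone_norm)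
  next
    case 4
    have rza: "of_real r * (z + a) = of_real (r * (a1 + s)) + of_real (r * (a2 + t)) * x" for r
      by (simp add: a12(3) st(3) algebra_simps)
    \<comment> \<open>\<open>z1\<close> is the entry point: the smallest \<open>r\<close> for which
      both coordinates of \<open>r (z + a) - a\<close> are nonnegative is the larger of
      \<open>a1 / (a1 + s)\<close> and \<open>a2 / (a2 + t)\<close>.\<close>
    have "\<exists>r z1. 0 < r \<and> r \<le> 1 \<and> z1 + a = of_real r * (z + a) \<and> cone x ((c + z1 * d) * cnj (a + z1))"
    proof (cases "a1 * (a2 + t) \<ge> a2 * (a1 + s)")
      case True
      define r where "r = a1 / (a1 + s)"
      have r: "r * (a1 + s) = a1"
        using 4 a12 by (simp add: r_def)
      have "a1 \<noteq> 0"
      proof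
        assume "a1 = 0"
        with True 4 a12 show False
          by (auto simp: mult_le_0_iff)
      qed
      then have "0 < r" "r \<le> 1"
        using 4 a12 by (auto simp: r_def)
      moreover have "r * (a2 + t) - a2 \<ge> 0"
        using True 4 a12 by (simp add: r_def field_simps)
      moreover have "of_real (r * (a2 + t) - a2) * x + a = of_real r * (z + a)"
        unfolding rza r by (simp add: a12 left_diff_distrib)
      ultimately show ?thesis
        using rx by blast
    next
      case False
      define r where "r = a2 / (a2 + t)"
      have r: "r * (a2 + t) = a2"
        using 4 a12 by (simp add: r_def)
      have "a2 \<noteq> 0"
        using False 4 a12 by (auto simp: not_le mult_less_0_iff)
      then have "0 < r" "r \<le> 1"
        using 4 a12 by (auto simp: r_def)
      moreover have "r * (a1 + s) - a1 \<ge> 0"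
        using False 4 a12 by (simp add: r_def field_simps)
      moreover have "of_real (r * (a1 + s) - a1) + a = of_real r * (z + a)"
        unfolding rza r by (simp add: a12 left_diff_distrib)
      ultimately show ?thesis
        using r1 by blast
    qed
    then obtain r z1 where r: "0 < r" "r \<le> 1" and z1: "z1 + a = of_real r * (z + a)"
      and D: "cone x ((c + z1 * d) * cnj (a + z1))"
      by blast
    have "cone x (of_real (r * (1 - r)) * ((z + a) * cnj (z + a) * d))"
      using r d by (intro cone_scale cone_norm) auto
    with D have "cone x ((c + z1 * d) * cnj (a + z1) + of_real (r * (1 - r)) * ((z + a) * cnj (z + a) * d))"
      by (rule cone_add)
    \<comment> \<open>This is \<open>f z = r * f z1 + (1 - r) * d\<close> for
      \<open>f z = (c + z * d) / (a + z)\<close>, cleared of denominators.\<close>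
    moreover have "(c + z1 * d) * cnj (a + z1) + of_real (r * (1 - r)) * ((z + a) * cnj (z + a) * d)
        = of_real r * ((c + z * d) * cnj (a + z))"
    proof -
      have c1: "cnj (a + z1) = of_real r * cnj (a + z)"
        using arg_cong[OF z1, of cnj] by (simp add: add.commute)
      have zz: "z1 = of_real r * (z + a) - a"
        using z1 by (simp add: algebra_simps)
      then show ?thesis
        by (simp only: c1) (simp add: zz algebra_simps)
    qed
    ultimately show ?thesis
      using r by (simp only: cone_scale_iff)
  qed
qed

text \<open>Division by \<open>f1\<close> and \<open>b\<close> gives the fractional linear map in
  \<open>z = a / b\<close> with pole \<open>- f0 / f1\<close>. For \<open>f1 = 0\<close> the map is
  affine, and \<open>b = 0\<close> is its value at infinity; limits of the ray hypotheses settle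
  both.\<close>

lemma cone_from_rays:
  assumes x: "Im x > 0" and f: "cone x (f0 * cnj f1)" and ab: "cone x (a * cnj b)"
    and r1: "\<And>t. t > 0 \<Longrightarrow> cone x ((g0 + of_real t * g1) * cnj (f0 + of_real t * f1))"
    and rx: "\<And>t. t > 0 \<Longrightarrow> cone x ((g0 + of_real t * x * g1) * cnj (f0 + of_real t * x * f1))"
  shows "cone x ((b * g0 + a * g1) * cnj (b * f0 + a * f1))"
proof -
  have "cone x (g0 * cnj f0 + of_real t * (g0 * cnj f1 + g1 * cnj f0) + of_real (t\<^sup>2) * (g1 * cnj f1))"
    if "t > 0" for t
    using r1[OF that] by (simp add: algebra_simps power2_eq_square)
  from cone_limits[OF this] have g00: "cone x (g0 * cnj f0)" and g11: "cone x (g1 * cnj f1)"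
    by auto
  show ?thesis
  proof (cases "f1 = 0")
    case True
    have "cone x (g1 * cnj f0 + of_real t * (g0 * cnj f0) + of_real (t\<^sup>2) * 0)" if "t > 0" for t
    proof -
      have "cone x (of_real t * ((g0 + of_real (1 / t) * g1) * cnj f0))"
        using r1[of "1 / t"] that True by (intro cone_scale) auto
      with that show ?thesis
        by (simp add: algebra_simps)
    qed
    from cone_limits(1)[OF this] have 1: "cone x (g1 * cnj f0)" .
    have "cone x (x * (g1 * cnj f0) + of_real t * (g0 * cnj f0) + of_real (t\<^sup>2) * 0)" if "t > 0" for t
    proof -
      have "cone x (of_real t * ((g0 + of_real (1 / t) * x * g1) * cnj f0))"
        using rx[of "1 / t"] that True by (intro cone_scale) auto
      with that show ?thesis
        by (simp add: algebra_simps)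
    qed
    from cone_limits(1)[OF this] have 2: "cone x (x * (g1 * cnj f0))" .
    obtain s t where st: "s \<ge> 0" "t \<ge> 0" "a * cnj b = of_real s + of_real t * x"
      using ab cone_iff[OF x] by blast
    have "(b * g0 + a * g1) * cnj (b * f0 + a * f1) = b * cnj b * (g0 * cnj f0) + (a * cnj b) * (g1 * cnj f0)"
      using True by (simp add: algebra_simps)
    also have "\<dots> = b * cnj b * (g0 * cnj f0) + of_real s * (g1 * cnj f0) + of_real t * (x * (g1 * cnj f0))"
      by (simp only: st) (simp add: algebra_simps)
    finally show ?thesis
      using 1 2 g00 st by (simp only:) (intro cone_add cone_scale cone_norm)
  next
    case f1: False
    define \<alpha> where "\<alpha> = f0 / f1"
    have f0: "f0 = \<alpha> * f1"
      using f1 by (simp add: \<alpha>_def)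
    have m: "(norm f1)\<^sup>2 > 0"
      using f1 by simp
    have "f0 * cnj f1 = of_real ((norm f1)\<^sup>2) * \<alpha>"
      by (simp only: complex_norm_square f0) (simp add: mult_ac)
    with f have \<alpha>: "cone x \<alpha>"
      using m by (simp only: cone_scale_iff)
    show ?thesis
    proof (cases "b = 0")
      case True
      have "(b * g0 + a * g1) * cnj (b * f0 + a * f1) = a * cnj a * (g1 * cnj f1)"
        using True by (simp add: algebra_simps)
      then show ?thesis
        using g11 by (simp only: cone_norm)
    next
      case b: False
      define z where "z = a / b"
      have az: "a = z * b"
        using b by (simp add: z_def)
      have n: "(norm b)\<^sup>2 > 0"
        using b by simp
      have "a * cnj b = of_real ((norm b)\<^sup>2) * z"
        by (simp only: complex_norm_square az) (simp add: mult_ac)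
      with ab have z: "cone x z"
        using n by (simp only: cone_scale_iff)
      have 1: "cone x ((g0 * cnj f1 + of_real t * (g1 * cnj f1)) * cnj (\<alpha> + of_real t))" if "t \<ge> 0" for t
      proof (cases "t = 0")
        case True
        with g00 show ?thesis
          by (simp add: f0 mult_ac)
      next
        case False
        with r1[of t] that show ?thesis
          by (simp add: f0 algebra_simps)
      qed
      have 2: "cone x ((g0 * cnj f1 + of_real t * x * (g1 * cnj f1)) * cnj (\<alpha> + of_real t * x))" if "t \<ge> 0" for t
      proof (cases "t = 0")
        case True
        with g00 show ?thesis
          by (simp add: f0 mult_ac)
      next
        case False
        with rx[of t] that show ?thesis
          by (simp add: f0 algebra_simps)
      qed
      have "cone x ((g0 * cnj f1 + z * (g1 * cnj f1)) * cnj (\<alpha> + z))"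
        by (rule cone_fractional_linear[OF x \<alpha> z g11 1 2])
      then have "cone x (b * cnj b * ((g0 * cnj f1 + z * (g1 * cnj f1)) * cnj (\<alpha> + z)))"
        by (rule cone_norm)
      then show ?thesis
        by (simp add: f0 az algebra_simps)
    qed
  qed
qed

lemma hsquare_imp:
  assumes "hsquare K J"
  shows "hurwitz K" "hurwitz J" "square_rel K J"
proof -
  note sq = assms[unfolded hsquare_def interp_square_def, rule_format]
  have hurwitzI: "hurwitz p"
    if "interp_cube1 (odd_part p) (even_part p) \<or> interp_cube1 (even_part p) ([:0, 1:] * odd_part p)" for p
    using that
  proof
    assume "interp_cube1 (odd_part p) (even_part p)"
    then have c: "odd_part p = 0 \<or> nonneg_coeffs (odd_part p) \<and> zero_free (odd_part p)"
      "even_part p = 0 \<or> nonneg_coeffs (even_part p) \<and> zero_free (even_part p)"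
      "\<And>x. Im x > 0 \<Longrightarrow> cone x (Ev p x * cnj (Od p x))"
      unfolding interp_cube1_iff by blast+
    then show "hurwitz p"
      unfolding hurwitz_def nonneg_coeffs_parts_iff[of p]
      by (metis nonneg_coeffs_0 parts_eq_0_iff zero_free_def)
  next
    assume "interp_cube1 (even_part p) ([:0, 1:] * odd_part p)"
    then have c: "odd_part p = 0 \<or> nonneg_coeffs (odd_part p) \<and> zero_free (odd_part p)"
      "even_part p = 0 \<or> nonneg_coeffs (even_part p) \<and> zero_free (even_part p)"
      "\<And>x. Im x > 0 \<Longrightarrow> cone x (x * Od p x * cnj (Ev p x))"
      unfolding interp_cube1_iff by (auto simp: zero_free_def)
    \<comment> \<open>Reflection turns the condition on the parts of \<open>u p\<close> into the one
      on the parts of \<open>p\<close>.\<close>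
    have "cone x (Ev p x * cnj (Od p x))" if x: "Im x > 0" for x
    proof -
      have "x * cnj (x * Od p x * cnj (Ev p x)) = of_real ((norm x)\<^sup>2) * (Ev p x * cnj (Od p x))"
        by (simp only: complex_norm_square) (simp add: mult_ac)
      moreover have "(norm x)\<^sup>2 > 0"
        using x by auto
      ultimately show ?thesis
        using cone_cnj[OF c(3)[OF x]] by (simp only: cone_scale_iff)
    qed
    with c show "hurwitz p"
      unfolding hurwitz_def nonneg_coeffs_parts_iff[of p]
      by (metis nonneg_coeffs_0 parts_eq_0_iff zero_free_def)
  qed
  \<comment> \<open>The square speaks only of mixed combinations; those in its first entries give
    the cube of \<open>K\<close>, those in its second entries the cube of
    \<open>u J\<close>.\<close>
  have "interp_cube1 (odd_part K) (even_part K)" "interp_cube1 (even_part J) ([:0, 1:] * odd_part J)"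
    by (rule interp_cube1_from_rays; use sq[unfolded interp_cube1_iff] in blast)+
  then show K: "hurwitz K" and "hurwitz J"
    using hurwitzI by blast+
  show "square_rel K J"
    unfolding square_rel_def
  proof (intro allI impI)
    fix x a b assume x: "Im x > 0" and ab: "cone x (a * cnj b)"
    have "cone x ((b * (x * Od J x) + a * Ev J x) * cnj (b * Ev K x + a * Od K x))"
    proof (rule cone_from_rays[OF x _ ab])
      show "cone x (Ev K x * cnj (Od K x))"
        using K x by (simp add: hurwitz_def)
    next
      fix t :: real assume t: "t > 0"
      from sq[OF t zero_less_one] have "\<forall>x. Im x > 0 \<longrightarrow>
          cone x (ceval (smult t (even_part J) + smult 1 ([:0, 1:] * odd_part J)) x
            * cnj (ceval (smult t (odd_part K) + smult 1 (even_part K)) x))"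
        unfolding interp_cube1_iff by blast
      with x have "cone x (ceval (smult t (even_part J) + smult 1 ([:0, 1:] * odd_part J)) x
            * cnj (ceval (smult t (odd_part K) + smult 1 (even_part K)) x))"
        by blast
      then show "cone x ((x * Od J x + of_real t * Ev J x) * cnj (Ev K x + of_real t * Od K x))"
        by (simp add: algebra_simps)
    next
      fix t :: real assume t: "t > 0"
      from sq[OF zero_less_one t] have "\<forall>x. Im x > 0 \<longrightarrow>
          cone x (ceval (smult 1 ([:0, 1:] * odd_part J) + smult t ([:0, 1:] * even_part J)) x
            * cnj (ceval (smult 1 (even_part K) + smult t ([:0, 1:] * odd_part K)) x))"
        unfolding interp_cube1_iff by blast
      with x have "cone x (ceval (smult 1 ([:0, 1:] * odd_part J) + smult t ([:0, 1:] * even_part J)) x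
            * cnj (ceval (smult 1 (even_part K) + smult t ([:0, 1:] * odd_part K)) x))"
        by blast
      then show "cone x ((x * Od J x + of_real t * x * Ev J x) * cnj (Ev K x + of_real t * x * Od K x))"
        by (simp add: algebra_simps)
    qed
    then show "cone x (lin x (b * x) a J * cnj (lin x a b K))"
      by (simp add: lin_def algebra_simps)
  qed
qed

text \<open>Each of \<open>K K'\<close>, \<open>J J'\<close> shares a factor with each of
  \<open>K J'\<close>, \<open>J K'\<close>, so every such pair is a multiple of a given square, read
  in one direction or the other. Both conclusions follow by adding.\<close>

lemma hsquare_mult:
  assumes "hsquare K J" "hsquare K' J'"
  shows "hsquare (K * K' + J * J') (K * J' + J * K')" "hsquare (K * J' + J * K') (J * J')"
proof -
  note h = hsquare_imp(1,2)[OF assms(1)] hsquare_imp(1,2)[OF assms(2)]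
  note n = h[unfolded hurwitz_def, THEN conjunct1]
  note s = hsquare_imp(3)[OF assms(1)] hsquare_imp(3)[OF assms(2)]
  note s = s s[THEN square_rel_sym]
  have sq: "square_rel (K * K') (K * J')" "square_rel (K * K') (J * K')"
    "square_rel (J * J') (K * J')" "square_rel (J * J') (J * K')"
    "square_rel (K * J') (J * J')" "square_rel (J * K') (J * J')"
    "square_rel (K * J') (K * K')" "square_rel (J * K') (K * K')"
    using square_rel_mult[OF h(1) s(2)] square_rel_mult[OF h(3) s(1)] square_rel_mult[OF h(4) s(3)]
      square_rel_mult[OF h(2) s(4)] square_rel_mult[OF h(4) s(1)] square_rel_mult[OF h(2) s(2)]
      square_rel_mult[OF h(1) s(4)] square_rel_mult[OF h(3) s(3)]
    by (simp_all add: mult.commute)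
  have nvJJ: "nonvanishing (J * J')"
    using h by (intro hurwitz_nonvanishing hurwitz_mult)
  have nv1: "nonvanishing (K * K' + J * J')"
  \<comment> \<open>If \<open>K * J'\<close> is zero, one of its factors is, and at most one summand
    is nonzero; otherwise \<open>K * J'\<close> keeps the summands from cancelling.\<close>
  proof (cases "K * J' = 0")
    case True
    then show ?thesis
      using h by (auto intro!: hurwitz_nonvanishing hurwitz_mult)
  qed (intro nonvanishing_add[of _ _ "K * J'"] hurwitz_mult h sq)
  have nv2: "nonvanishing (K * J' + J * K')"
  proof (cases "K * K' = 0")
    case True
    then show ?thesis
      using h by (auto intro!: hurwitz_nonvanishing hurwitz_mult)
  qed (intro nonvanishing_add[of _ _ "K * K'"] hurwitz_mult h sq)
  show "hsquare (K * K' + J * J') (K * J' + J * K')"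
    by (intro hsquareI nv1 nv2 square_rel_add_left square_rel_add_right sq nonneg_coeffs_add nonneg_coeffs_mult n)
  show "hsquare (K * J' + J * K') (J * J')"
    by (intro hsquareI nvJJ nv2 square_rel_add_left sq nonneg_coeffs_add nonneg_coeffs_mult n)
qed

lemma hsquare_hurwitz_0:
  assumes "hurwitz F"
  shows "hsquare F 0"
proof (rule hsquareI)
  show "nonneg_coeffs F"
    using assms by (simp add: hurwitz_def)
  show "square_rel F 0"
    by (simp add: square_rel_def lin_def)
qed (use assms hurwitz_nonvanishing in \<open>auto simp: nonvanishing_def\<close>)

text \<open>The pair \<open>(K, J)\<close> of a single edge that is kept instead of deleted: by
  itself the edge contributes \<open>1\<close>, and as a loop after identification
  \<open>u - 1\<close>, with sum \<open>u\<close>.\<close>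

lemma hsquare_edge: "hsquare [:0, 1:] 1"
proof (rule hsquareI)
  have parts: "even_part 1 = 1" "odd_part 1 = 0"
    by (simp_all add: one_pCons)
  show "nonvanishing [:0, 1:]" "nonvanishing 1"
    by (simp_all add: nonvanishing_def lin_def parts)
  show "square_rel [:0, 1:] 1"
    unfolding square_rel_def
  proof (intro allI impI)
    fix x a b :: complex assume "Im x > 0"
    then have "cone x (of_real ((norm a)\<^sup>2))"
      by (intro cone_of_real) auto
    then show "cone x (lin x (b * x) a 1 * cnj (lin x a b [:0, 1:]))"
      by (simp only: complex_norm_square) (simp add: lin_def parts)
  qed
qed auto

section \<open>Connected spanning subgraphs\<close>


text \<open>Connectedness, after identifying the pairs in \<open>R\<close>, expressed through two-colourings
  instead of paths.\<close>
definition linked :: "'a set \<Rightarrow> ('e \<Rightarrow> 'a \<times> 'a) \<Rightarrow> ('a \<times> 'a) set \<Rightarrow> 'e set \<Rightarrow> bool" where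
  "linked V f R S \<longleftrightarrow> (\<forall>c :: 'a \<Rightarrow> bool. (\<forall>e\<in>S. c (fst (f e)) = c (snd (f e))) \<longrightarrow> (\<forall>(a, b)\<in>R. c a = c b)
     \<longrightarrow> (\<forall>x\<in>V. \<forall>y\<in>V. c x = c y))"

lemma linkedI:
  assumes "\<And>c x y. (\<And>e. e \<in> S \<Longrightarrow> c (fst (f e)) = c (snd (f e))) \<Longrightarrow> (\<And>a b. (a, b) \<in> R \<Longrightarrow> c a = c b)
    \<Longrightarrow> x \<in> V \<Longrightarrow> y \<in> V \<Longrightarrow> c x = (c y :: bool)"
  shows "linked V f R S"
  unfolding linked_def
proof (intro allI impI ballI)
  fix c :: "'a \<Rightarrow> bool" and x y
  assume c: "\<forall>e\<in>S. c (fst (f e)) = c (snd (f e))" "\<forall>(a, b)\<in>R. c a = c b" and xy: "x \<in> V" "y \<in> V"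
  show "c x = c y"
    by (rule assms) (use c xy in auto)
qed

lemma linkedD:
  assumes "linked V f R S" "\<And>e. e \<in> S \<Longrightarrow> c (fst (f e)) = c (snd (f e))" "\<And>a b. (a, b) \<in> R \<Longrightarrow> c a = c b"
    "x \<in> V" "y \<in> V"
  shows "c x = (c y :: bool)"
proof -
  have "\<forall>e\<in>S. c (fst (f e)) = c (snd (f e))"
    using assms(2) by blast
  moreover have "\<forall>(a, b)\<in>R. c a = c b"
    by (rule ballI, clarify, rule assms(3))
  ultimately show ?thesis
    using assms(1,4,5) unfolding linked_def by blast
qed

lemma conn_spanning_iff_linked: "conn_spanning G S \<longleftrightarrow> linked (verts G) (ends G) {} S"
proof
  assume conn: "conn_spanning G S"
  show "linked (verts G) (ends G) {} S"
  proof (rule linkedI)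
    fix c :: "'a \<Rightarrow> bool" and x y
    assume c: "\<And>e. e \<in> S \<Longrightarrow> c (fst (ends G e)) = c (snd (ends G e))" and xy: "x \<in> verts G" "y \<in> verts G"
    have "c x = c z" if "(x, z) \<in> (adj_rel (ends G) S)\<^sup>*" for z
      using that
    proof (induction rule: rtrancl_induct)
      case (step y z)
      then obtain e where e: "e \<in> S" "ends G e = (y, z) \<or> ends G e = (z, y)"
        by (auto simp: adj_rel_def)
      have "c y = c z"
        using e(2) c[OF e(1)] by (elim disjE) simp_all
      with step.IH show ?case
        by simp
    qed simp
    with conn xy show "c x = c y"
      by (simp add: conn_spanning_def)
  qed
next
  assume linked: "linked (verts G) (ends G) {} S"
  show "conn_spanning G S"
    unfolding conn_spanning_def
  proof (intro ballI)
    fix x y assume xy: "x \<in> verts G" "y \<in> verts G"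
    define c where "c z \<longleftrightarrow> (x, z) \<in> (adj_rel (ends G) S)\<^sup>*" for z
    have "c x = c y"
    proof (rule linkedD[OF linked _ _ xy])
      fix e assume "e \<in> S"
      obtain p q where pq: "ends G e = (p, q)"
        by (cases "ends G e")
      have adj: "(p, q) \<in> adj_rel (ends G) S" "(q, p) \<in> adj_rel (ends G) S"
        using \<open>e \<in> S\<close> pq by (auto simp: adj_rel_def)
      have "c p = c q"
        unfolding c_def using adj by (meson rtrancl.rtrancl_into_rtrancl)
      then show "c (fst (ends G e)) = c (snd (ends G e))"
        by (simp only: pq fst_conv snd_conv)
    qed simp
    then show "(x, y) \<in> (adj_rel (ends G) S)\<^sup>*"
      by (simp add: c_def)
  qed
qed

lemma linked_cong:
  fixes f g :: "'e \<Rightarrow> 'a \<times> 'a"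
  assumes "\<And>e. e \<in> S \<Longrightarrow> f e = g e"
  shows "linked V f R S \<longleftrightarrow> linked V g R S"
proof -
  have "(\<forall>e\<in>S. c (fst (f e)) = c (snd (f e))) \<longleftrightarrow> (\<forall>e\<in>S. c (fst (g e)) = c (snd (g e)))" for c :: "'a \<Rightarrow> bool"
    using assms by simp
  then show ?thesis
    by (simp only: linked_def)
qed

lemma linked_mono:
  assumes "R \<subseteq> R'" "linked V f R S"
  shows "linked V f R' S"
proof (rule linkedI)
  fix c :: "'a \<Rightarrow> bool" and x y
  assume c: "\<And>e. e \<in> S \<Longrightarrow> c (fst (f e)) = c (snd (f e))" "\<And>a b. (a, b) \<in> R' \<Longrightarrow> c a = c b"
    and xy: "x \<in> V" "y \<in> V"
  show "c x = c y"
    by (rule linkedD[OF assms(2) c(1) _ xy]) (use c(2) assms(1) in blast)+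
qed

lemma linked_insert_edge:
  fixes f :: "'e \<Rightarrow> 'a \<times> 'a"
  assumes "f e = (a, b) \<or> f e = (b, a)"
  shows "linked V f R (insert e S) \<longleftrightarrow> linked V f (insert (a, b) R) S"
proof -
  have e: "c (fst (f e)) = c (snd (f e)) \<longleftrightarrow> c a = c b" for c :: "'a \<Rightarrow> bool"
    using assms by auto
  show ?thesis
  proof
    assume L: "linked V f R (insert e S)"
    show "linked V f (insert (a, b) R) S"
    proof (rule linkedI)
      fix c :: "'a \<Rightarrow> bool" and x y
      assume c: "\<And>e. e \<in> S \<Longrightarrow> c (fst (f e)) = c (snd (f e))" "\<And>p q. (p, q) \<in> insert (a, b) R \<Longrightarrow> c p = c q"
        and xy: "x \<in> V" "y \<in> V"
      show "c x = c y"
        by (rule linkedD[OF L _ _ xy]) (use c e in blast)+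
    qed
  next
    assume L: "linked V f (insert (a, b) R) S"
    show "linked V f R (insert e S)"
    proof (rule linkedI)
      fix c :: "'a \<Rightarrow> bool" and x y
      assume c: "\<And>e'. e' \<in> insert e S \<Longrightarrow> c (fst (f e')) = c (snd (f e'))" "\<And>p q. (p, q) \<in> R \<Longrightarrow> c p = c q"
        and xy: "x \<in> V" "y \<in> V"
      show "c x = c y"
        by (rule linkedD[OF L _ _ xy]) (use c e in blast)+
    qed
  qed
qed

text \<open>Colourings of the quotient are the colourings of \<open>V\<close> that agree on
  \<open>a\<close> and \<open>b\<close>; the pairs in \<open>R\<close> avoid \<open>b\<close>, whose
  name disappears.\<close>

lemma linked_identify:
  fixes a b :: 'a
  assumes "\<And>p q. (p, q) \<in> R \<Longrightarrow> p \<noteq> b \<and> q \<noteq> b"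
  defines "\<phi> \<equiv> (\<lambda>x. if x = b then a else x)"
  shows "linked (\<phi> ` V) (\<lambda>e. map_prod \<phi> \<phi> (f e)) R S \<longleftrightarrow> linked V f (insert (a, b) R) S"
proof
  assume L: "linked (\<phi> ` V) (\<lambda>e. map_prod \<phi> \<phi> (f e)) R S"
  show "linked V f (insert (a, b) R) S"
  proof (rule linkedI)
    fix c :: "'a \<Rightarrow> bool" and x y
    assume c: "\<And>e. e \<in> S \<Longrightarrow> c (fst (f e)) = c (snd (f e))" and R: "\<And>p q. (p, q) \<in> insert (a, b) R \<Longrightarrow> c p = c q"
      and xy: "x \<in> V" "y \<in> V"
    have [simp]: "c (\<phi> z) = c z" for z
      using R by (auto simp: \<phi>_def)
    have "c (\<phi> x) = c (\<phi> y)"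
      by (rule linkedD[OF L]) (use c R xy in auto)
    then show "c x = c y"
      by simp
  qed
next
  assume L: "linked V f (insert (a, b) R) S"
  show "linked (\<phi> ` V) (\<lambda>e. map_prod \<phi> \<phi> (f e)) R S"
  proof (rule linkedI)
    fix c :: "'a \<Rightarrow> bool" and x y
    assume c: "\<And>e. e \<in> S \<Longrightarrow> c (fst (map_prod \<phi> \<phi> (f e))) = c (snd (map_prod \<phi> \<phi> (f e)))"
      and R: "\<And>p q. (p, q) \<in> R \<Longrightarrow> c p = c q" and "x \<in> \<phi> ` V" "y \<in> \<phi> ` V"
    then obtain x' y' where xy: "x' \<in> V" "y' \<in> V" "x = \<phi> x'" "y = \<phi> y'"
      by blast
    have "(c \<circ> \<phi>) x' = (c \<circ> \<phi>) y'"
    proof (rule linkedD[OF L])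
      show "(c \<circ> \<phi>) p = (c \<circ> \<phi>) q" if "(p, q) \<in> insert (a, b) R" for p q
        using that R assms(1) by (auto simp: \<phi>_def)
    qed (use c xy in auto)
    then show "c x = c y"
      by (simp add: xy)
  qed
qed

text \<open>A colouring of one side extends to the other side by the constant colour of
  \<open>v\<close>.\<close>

lemma linked_cut_vertex:
  assumes v: "V1 \<inter> V2 = {v}"
    and S: "\<And>e. e \<in> S1 \<Longrightarrow> f e \<in> V1 \<times> V1" "\<And>e. e \<in> S2 \<Longrightarrow> f e \<in> V2 \<times> V2"
    and R: "R1 \<subseteq> V1 \<times> V1" "R2 \<subseteq> V2 \<times> V2"
  shows "linked (V1 \<union> V2) f (R1 \<union> R2) (S1 \<union> S2) \<longleftrightarrow> linked V1 f R1 S1 \<and> linked V2 f R2 S2"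
proof
  assume L: "linked (V1 \<union> V2) f (R1 \<union> R2) (S1 \<union> S2)"
  have ext: "c x = c y" if V: "V \<inter> V' = {v}" "x \<in> V" "y \<in> V" "V1 \<union> V2 = V \<union> V'" "S1 \<union> S2 = S \<union> S'" "R1 \<union> R2 = R \<union> R'"
    and S: "\<And>e. e \<in> S \<Longrightarrow> f e \<in> V \<times> V" "\<And>e. e \<in> S' \<Longrightarrow> f e \<in> V' \<times> V'"
    and R: "R \<subseteq> V \<times> V" "R' \<subseteq> V' \<times> V'"
    and c: "\<And>e. e \<in> S \<Longrightarrow> c (fst (f e)) = c (snd (f e))" "\<And>p q. (p, q) \<in> R \<Longrightarrow> c p = c q"
    for c :: "'a \<Rightarrow> bool" and x y V V' S S' R R'
  proof -
    define d where "d z = (if z \<in> V then c z else c v)" for z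
    have 1: "d z = c z" if "z \<in> V" for z
      using that by (simp add: d_def)
    have 2: "d z = c v" if "z \<in> V'" for z
      using that V(1) by (auto simp: d_def)
    have "d x = d y"
    proof (rule linkedD[OF L])
      fix e assume "e \<in> S1 \<union> S2"
      then have "e \<in> S \<or> e \<in> S'"
        using V by simp
      then show "d (fst (f e)) = d (snd (f e))"
      proof
        assume "e \<in> S"
        with S(1)[of e] c(1)[of e] show ?thesis
          by (simp add: 1 mem_Times_iff)
      next
        assume "e \<in> S'"
        with S(2)[of e] show ?thesis
          by (simp add: 2 mem_Times_iff)
      qed
    next
      fix p q assume "(p, q) \<in> R1 \<union> R2"
      then have "(p, q) \<in> R \<or> (p, q) \<in> R'"
        using V by simp
      then show "d p = d q"
      proof
        assume pq: "(p, q) \<in> R"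
        then have "p \<in> V" "q \<in> V"
          using R(1) by auto
        with c(2)[OF pq] show ?thesis
          by (simp add: 1)
      next
        assume "(p, q) \<in> R'"
        then have "p \<in> V'" "q \<in> V'"
          using R(2) by auto
        then show ?thesis
          by (simp add: 2)
      qed
    qed (use V in auto)
    then show ?thesis
      using V by (simp add: 1)
  qed
  show "linked V1 f R1 S1 \<and> linked V2 f R2 S2"
  proof (intro conjI linkedI)
    fix c :: "'a \<Rightarrow> bool" and x y
    assume c: "\<And>e. e \<in> S1 \<Longrightarrow> c (fst (f e)) = c (snd (f e))" "\<And>p q. (p, q) \<in> R1 \<Longrightarrow> c p = c q"
      and xy: "x \<in> V1" "y \<in> V1"
    show "c x = c y"
      by (rule ext[OF v xy refl refl refl]; (fact S | fact R | fact c))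
  next
    fix c :: "'a \<Rightarrow> bool" and x y
    assume c: "\<And>e. e \<in> S2 \<Longrightarrow> c (fst (f e)) = c (snd (f e))" "\<And>p q. (p, q) \<in> R2 \<Longrightarrow> c p = c q"
      and xy: "x \<in> V2" "y \<in> V2"
    have v': "V2 \<inter> V1 = {v}"
      using v by (simp only: Int_commute)
    show "c x = c y"
      by (rule ext[OF v' xy Un_commute Un_commute Un_commute]; (fact S | fact R | fact c))
  qed
next
  assume L: "linked V1 f R1 S1 \<and> linked V2 f R2 S2"
  show "linked (V1 \<union> V2) f (R1 \<union> R2) (S1 \<union> S2)"
  proof (rule linkedI)
    fix c :: "'a \<Rightarrow> bool" and x y
    assume c: "\<And>e. e \<in> S1 \<union> S2 \<Longrightarrow> c (fst (f e)) = c (snd (f e))" "\<And>p q. (p, q) \<in> R1 \<union> R2 \<Longrightarrow> c p = c q"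
      and xy: "x \<in> V1 \<union> V2" "y \<in> V1 \<union> V2"
    have vV: "v \<in> V1" "v \<in> V2"
      using v by auto
    have "c z = c v" if "z \<in> V1 \<union> V2" for z
      using that
    proof
      assume z: "z \<in> V1"
      show ?thesis
        by (rule linkedD[OF L[THEN conjunct1] _ _ z vV(1)]; rule c; simp)
    next
      assume z: "z \<in> V2"
      show ?thesis
        by (rule linkedD[OF L[THEN conjunct2] _ _ z vV(2)]; rule c; simp)
    qed
    with xy show "c x = c y"
      by metis
  qed
qed

text \<open>The glued graph is held together at two vertices, \<open>v\<close> and the image of
  \<open>a\<close> and \<open>b\<close>, so at most one side may fail to join them.\<close>

lemma linked_parallel:
  assumes v: "V1 \<inter> V2 = {v}" and a: "a \<in> V1" and b: "b \<in> V2"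
    and S: "\<And>e. e \<in> S1 \<Longrightarrow> f e \<in> V1 \<times> V1" "\<And>e. e \<in> S2 \<Longrightarrow> f e \<in> V2 \<times> V2"
  shows "linked (V1 \<union> V2) f {(a, b)} (S1 \<union> S2) \<longleftrightarrow>
    linked V1 f {} S1 \<and> linked V2 f {(v, b)} S2 \<or> linked V1 f {(v, a)} S1 \<and> linked V2 f {} S2"
proof
  assume L: "linked (V1 \<union> V2) f {(a, b)} (S1 \<union> S2)"
  have glue: "(\<forall>x\<in>V1. \<forall>y\<in>V1. c1 x = c1 y) \<and> (\<forall>x\<in>V2. \<forall>y\<in>V2. c2 x = c2 y)"
    if c: "\<And>e. e \<in> S1 \<Longrightarrow> c1 (fst (f e)) = c1 (snd (f e))" "\<And>e. e \<in> S2 \<Longrightarrow> c2 (fst (f e)) = c2 (snd (f e))"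
      and eq: "c1 v = c2 v" "c1 a = c2 b" for c1 c2 :: "'a \<Rightarrow> bool"
  proof -
    define d where "d z = (if z \<in> V1 then c1 z else c2 z)" for z
    have 1: "d z = c1 z" if "z \<in> V1" for z
      using that by (simp add: d_def)
    have 2: "d z = c2 z" if "z \<in> V2" for z
    proof (cases "z \<in> V1")
      case True
      with that v have "z = v"
        by blast
      with eq True show ?thesis
        by (simp add: d_def)
    qed (simp add: d_def)
    have "d x = d y" if xy: "x \<in> V1 \<union> V2" "y \<in> V1 \<union> V2" for x y
    proof (rule linkedD[OF L _ _ xy])
      fix e assume "e \<in> S1 \<union> S2"
      then show "d (fst (f e)) = d (snd (f e))"
      proof
        assume "e \<in> S1"
        with S(1)[of e] c(1)[of e] show ?thesis
          by (simp add: 1 mem_Times_iff)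
      next
        assume "e \<in> S2"
        with S(2)[of e] c(2)[of e] show ?thesis
          by (simp add: 2 mem_Times_iff)
      qed
    next
      fix p q assume "(p, q) \<in> {(a, b)}"
      then show "d p = d q"
        using 1[OF a] 2[OF b] eq by simp
    qed
    with 1 2 show ?thesis
      by (metis UnCI)
  qed
  have L2: "linked V2 f {(v, b)} S2"
  proof (rule linkedI)
    fix c :: "'a \<Rightarrow> bool" and x y
    assume c: "\<And>e. e \<in> S2 \<Longrightarrow> c (fst (f e)) = c (snd (f e))" "\<And>p q. (p, q) \<in> {(v, b)} \<Longrightarrow> c p = c q"
      and xy: "x \<in> V2" "y \<in> V2"
    have "\<forall>x\<in>V2. \<forall>y\<in>V2. c x = c y"
      by (rule glue[of "\<lambda>_. c v" c, THEN conjunct2]) (simp_all add: c)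
    with xy show "c x = c y"
      by blast
  qed
  have L1: "linked V1 f {(v, a)} S1"
  proof (rule linkedI)
    fix c :: "'a \<Rightarrow> bool" and x y
    assume c: "\<And>e. e \<in> S1 \<Longrightarrow> c (fst (f e)) = c (snd (f e))" "\<And>p q. (p, q) \<in> {(v, a)} \<Longrightarrow> c p = c q"
      and xy: "x \<in> V1" "y \<in> V1"
    have "c a = c v"
      using c(2)[of v a] by simp
    then have "\<forall>x\<in>V1. \<forall>y\<in>V1. c x = c y"
      by (intro glue[of c "\<lambda>_. c v", THEN conjunct1]) (simp_all add: c)
    with xy show "c x = c y"
      by blast
  qed
  have vV: "v \<in> V1" "v \<in> V2"
    using v by auto
  have "linked V1 f {} S1 \<or> linked V2 f {} S2"
  proof (rule ccontr)
    assume n: "\<not> ?thesis"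
    then obtain c1 :: "'a \<Rightarrow> bool" where c1: "\<forall>e\<in>S1. c1 (fst (f e)) = c1 (snd (f e))"
        "\<not> (\<forall>x\<in>V1. \<forall>y\<in>V1. c1 x = c1 y)"
      unfolding linked_def by auto
    from n obtain c2 :: "'a \<Rightarrow> bool" where c2: "\<forall>e\<in>S2. c2 (fst (f e)) = c2 (snd (f e))"
        "\<not> (\<forall>x\<in>V2. \<forall>y\<in>V2. c2 x = c2 y)"
      unfolding linked_def by auto
    have "c1 v \<noteq> c1 a"
      using L1 c1 unfolding linked_def by blast
    moreover have "c2 v \<noteq> c2 b"
      using L2 c2 unfolding linked_def by blast
    \<comment> \<open>With two colours there is no freedom left: either \<open>c2\<close> or its
      complement agrees with \<open>c1\<close> at \<open>v\<close>, and then also at the glued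
      vertex.\<close>
    ultimately show False
      using glue[of c1 c2] glue[of c1 "\<lambda>z. \<not> c2 z"] c1 c2 by blast
  qed
  with L1 L2 show "linked V1 f {} S1 \<and> linked V2 f {(v, b)} S2 \<or> linked V1 f {(v, a)} S1 \<and> linked V2 f {} S2"
    by blast
next
  assume L: "linked V1 f {} S1 \<and> linked V2 f {(v, b)} S2 \<or> linked V1 f {(v, a)} S1 \<and> linked V2 f {} S2"
  show "linked (V1 \<union> V2) f {(a, b)} (S1 \<union> S2)"
  proof (rule linkedI)
    fix c :: "'a \<Rightarrow> bool" and x y
    assume c: "\<And>e. e \<in> S1 \<union> S2 \<Longrightarrow> c (fst (f e)) = c (snd (f e))" "\<And>p q. (p, q) \<in> {(a, b)} \<Longrightarrow> c p = c q"
      and xy: "x \<in> V1 \<union> V2" "y \<in> V1 \<union> V2"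
    have vV: "v \<in> V1" "v \<in> V2"
      using v by auto
    have ab: "c a = c b"
      using c(2) by simp
    have c1: "\<And>e. e \<in> S1 \<Longrightarrow> c (fst (f e)) = c (snd (f e))" and c2: "\<And>e. e \<in> S2 \<Longrightarrow> c (fst (f e)) = c (snd (f e))"
      using c(1) by simp_all
    have "c v = c a"
      using L
    proof
      assume "linked V1 f {} S1 \<and> linked V2 f {(v, b)} S2"
      then show ?thesis
        using linkedD[of V1 f "{}" S1 c v a] c1 a vV by simp
    next
      assume "linked V1 f {(v, a)} S1 \<and> linked V2 f {} S2"
      then show ?thesis
        using linkedD[of V2 f "{}" S2 c v b] c2 b vV ab by simp
    qed
    have L1: "linked V1 f {(v, a)} S1" and L2: "linked V2 f {(v, b)} S2"
      using L linked_mono[of "{}"] by blast+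
    have "c z = c v" if "z \<in> V1 \<union> V2" for z
      using that
    proof
      assume "z \<in> V1"
      then show ?thesis
        using linkedD[OF L1, of c z v] c1 vV \<open>c v = c a\<close> by simp
    next
      assume "z \<in> V2"
      then show ?thesis
        using linkedD[OF L2, of c z v] c2 vV \<open>c v = c a\<close> ab by simp
    qed
    with xy show "c x = c y"
      by metis
  qed
qed

text \<open>Starting from all vertices coloured differently, each edge costs at most one colour, and
  connectedness leaves only one. This makes the exponents in the reliability sum
  nonnegative.\<close>

lemma card_le_Suc_card_edges:
  assumes "finite V" "finite S" "linked V f {} S"
  shows "card V \<le> card S + 1"
proof -
  have "\<exists>c :: 'a \<Rightarrow> 'a. (\<forall>e\<in>S. c (fst (f e)) = c (snd (f e))) \<and> card V \<le> card (c ` V) + card S"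
    using assms(2)
  proof (induction S)
    case empty
    show ?case
      by (intro exI[of _ id]) simp
  next
    case (insert e S)
    then obtain c :: "'a \<Rightarrow> 'a" where c: "\<forall>e\<in>S. c (fst (f e)) = c (snd (f e))" "card V \<le> card (c ` V) + card S"
      by blast
    define d where "d x = (if c x = c (snd (f e)) then c (fst (f e)) else c x)" for x
    have "c ` V \<subseteq> insert (c (snd (f e))) (d ` V)"
      by (auto simp: d_def)
    then have "card (c ` V) \<le> card (insert (c (snd (f e))) (d ` V))"
      using assms(1) by (intro card_mono) auto
    also have "\<dots> \<le> Suc (card (d ` V))"
      by (rule card_insert_le_m1) auto
    finally have "card V \<le> card (d ` V) + card (insert e S)"
      using c insert by simp
    moreover have "\<forall>e'\<in>insert e S. d (fst (f e')) = d (snd (f e'))"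
      using c by (auto simp: d_def)
    ultimately show ?case
      by blast
  qed
  then obtain c :: "'a \<Rightarrow> 'a" where c: "\<forall>e\<in>S. c (fst (f e)) = c (snd (f e))" "card V \<le> card (c ` V) + card S"
    by blast
  have "c x = c y" if "x \<in> V" "y \<in> V" for x y
    using linkedD[OF assms(3), of "\<lambda>z. c z = c x" x y] c that by auto
  then have "\<forall>x\<in>c ` V. \<forall>y\<in>c ` V. x = y"
    by blast
  then have "card (c ` V) \<le> Suc 0"
    by (rule card_le_Suc0_iff_eq[OF finite_imageI[OF assms(1)], THEN iffD2])
  with c(2) show ?thesis
    by simp
qed

section \<open>The polynomial J as a weighted sum over edge sets\<close>

text \<open>Substituting \<open>q = (1 + u) / (u - 1)\<close> in \<open>R\<^sub>G\<close> turns \<open>1 - q\<close> into \<open>-2 / (u - 1)\<close>; for \<open>k = 1 - n\<close>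
  this is therefore \<open>J\<^sub>G\<close>. The integer power avoids truncated subtraction.\<close>
definition subset_sum :: "int \<Rightarrow> 'e set \<Rightarrow> ('e set \<Rightarrow> bool) \<Rightarrow> real poly" where
  "subset_sum k E P = (\<Sum>S\<in>{S. S \<subseteq> E \<and> P S}. smult ((-2) powi (k + int (card S))) ([:1, 1:] ^ (card E - card S)))"

lemma subset_sum_cong:
  assumes "k = k'" "E = E'" "\<And>S. S \<subseteq> E' \<Longrightarrow> P S \<longleftrightarrow> Q S"
  shows "subset_sum k E P = subset_sum k' E' Q"
proof -
  have "{S. S \<subseteq> E \<and> P S} = {S. S \<subseteq> E' \<and> Q S}"
    using assms(2,3) by blast
  then show ?thesis
    by (simp only: subset_sum_def assms(1,2))
qed

lemma poly_eq_off_1: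
  fixes p q :: "real poly"
  assumes "\<And>x. x \<noteq> 1 \<Longrightarrow> poly p x = poly q x"
  shows "p = q"
proof (rule ccontr)
  assume "p \<noteq> q"
  then have "finite {x. poly (p - q) x = 0}"
    by (intro poly_roots_finite) simp
  moreover have "UNIV - {1} \<subseteq> {x. poly (p - q) x = 0}"
    using assms by auto
  ultimately show False
    using infinite_UNIV_char_0[where 'a = real] by (metis finite_Diff2 finite.emptyI finite_insert finite_subset)
qed

lemma J_poly_eq:
  assumes fin: "finite (verts G)" "finite (edges G)"
  shows "J_poly G = subset_sum (1 - int (card (verts G))) (edges G) (linked (verts G) (ends G) {})"
proof -
  let ?n = "card (verts G)" and ?m = "card (edges G)"
  let ?A = "{S. S \<subseteq> edges G \<and> conn_spanning G S}"
  have S: "?n \<le> card S + 1" "card S \<le> ?m" if "S \<in> ?A" for S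
  proof -
    have "finite S"
      using that fin finite_subset by blast
    with that fin show "?n \<le> card S + 1"
      by (intro card_le_Suc_card_edges) (auto simp: conn_spanning_iff_linked)
    show "card S \<le> ?m"
      using that fin by (auto intro: card_mono)
  qed
  \<comment> \<open>The subtraction \<open>card S + 1 - ?n\<close> is exact, a connected spanning
    subgraph having at least \<open>?n - 1\<close> edges.\<close>
  define h :: "real poly" where "h = (\<Sum>S\<in>?A. [:1, -1:] ^ (card S + 1 - ?n) * [:0, 1:] ^ (?m - card S))"
  have poly_h: "poly h q = (\<Sum>S\<in>?A. (1 - q) ^ (card S + 1 - ?n) * q ^ (?m - card S))" for q
    by (simp add: h_def poly_sum)
  have h: "poly h q = (1 - q) powi (1 - int ?n) * poly (R_poly G) q" if q: "q \<noteq> 1" for q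
  proof -
    have "(1 - q) ^ (card S + 1 - ?n) = (1 - q) powi (1 - int ?n) * (1 - q) ^ card S" if "S \<in> ?A" for S
    proof -
      have "(1 - q) powi (1 - int ?n) * (1 - q) powi int (card S) = (1 - q) powi (1 - int ?n + int (card S))"
        using q by (simp add: power_int_add)
      also have "1 - int ?n + int (card S) = int (card S + 1 - ?n)"
        using S(1)[OF that] by simp
      finally show ?thesis
        by (simp only: power_int_of_nat)
    qed
    then show ?thesis
      by (simp add: h_def R_poly_def poly_sum sum_distrib_left mult.assoc)
  qed
  have H: "H_poly G = h"
    unfolding H_poly_def
  proof (rule the_equality)
    fix p assume p: "\<forall>q. q \<noteq> 1 \<longrightarrow> poly p q = (1 - q) powi (1 - int ?n) * poly (R_poly G) q"
    show "p = h"
      by (rule poly_eq_off_1) (use p h in simp)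
  qed (use h in blast)
  define j where "j = subset_sum (1 - int ?n) (edges G) (conn_spanning G)"
  have j: "poly j u = (u - 1) powi (int ?m - int ?n + 1) * poly h ((-1 - u) / (1 - u))" if u: "u \<noteq> 1" for u
  proof -
    have "(-2) powi (1 - int ?n + int (card S)) * (1 + u) ^ (?m - card S) =
        (u - 1) powi (int ?m - int ?n + 1) *
        ((1 - (-1 - u) / (1 - u)) ^ (card S + 1 - ?n) * ((-1 - u) / (1 - u)) ^ (?m - card S))"
      if "S \<in> ?A" for S
    proof -
      \<comment> \<open>\<open>a + b\<close> is the exponent of \<open>u - 1\<close>, so each of
        these factors clears one denominator.\<close>
      define a where "a = card S + 1 - ?n"
      define b where "b = ?m - card S"
      have 1: "1 - int ?n + int (card S) = int a" and 2: "int ?m - int ?n + 1 = int (a + b)"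
        using S[OF that] by (simp_all add: a_def b_def)
      have 3: "1 - (1 + u) / (u - 1) = -2 / (u - 1)" and 4: "(-1 - u) / (1 - u) = (1 + u) / (u - 1)"
        using u by (simp_all add: divide_simps) (simp_all add: algebra_simps)
      have "(u - 1) ^ (a + b) * ((-2 / (u - 1)) ^ a * ((1 + u) / (u - 1)) ^ b)
          = ((u - 1) * (-2 / (u - 1))) ^ a * ((u - 1) * ((1 + u) / (u - 1))) ^ b"
        by (simp only: power_add power_mult_distrib mult_ac)
      also have "(u - 1) * (-2 / (u - 1)) = -2"
        using u by (simp only: times_divide_eq_right) (rule nonzero_mult_div_cancel_left, simp)
      also have "(u - 1) * ((1 + u) / (u - 1)) = 1 + u"
        using u by (simp only: times_divide_eq_right) (rule nonzero_mult_div_cancel_left, simp)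
      finally show ?thesis
        unfolding 1 2 4 3 a_def[symmetric] b_def[symmetric] power_int_of_nat by (rule sym)
    qed
    note eq = this
    let ?q = "(-1 - u) / (1 - u)"
    have "poly j u = (\<Sum>S\<in>?A. (-2) powi (1 - int ?n + int (card S)) * (1 + u) ^ (?m - card S))"
      by (simp only: j_def subset_sum_def poly_sum poly_smult poly_power poly_pCons poly_0 mult_zero_right
          add_0_right mult_1_right)
    also have "\<dots> = (\<Sum>S\<in>?A. (u - 1) powi (int ?m - int ?n + 1) *
        ((1 - ?q) ^ (card S + 1 - ?n) * ?q ^ (?m - card S)))"
      by (intro sum.cong refl eq)
    also have "\<dots> = (u - 1) powi (int ?m - int ?n + 1) * poly h ?q"
      unfolding poly_h by (rule sum_distrib_left[symmetric])
    finally show ?thesis .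
  qed
  have "J_poly G = j"
    unfolding J_poly_def Let_def H
  proof (rule the_equality)
    fix p assume p: "\<forall>u. u \<noteq> 1 \<longrightarrow> poly p u = (u - 1) powi (int ?m - int ?n + 1) * poly h ((-1 - u) / (1 - u))"
    show "p = j"
      by (rule poly_eq_off_1) (metis p j)
  qed (use j in blast)
  moreover have "conn_spanning G = linked (verts G) (ends G) {}"
    by (rule ext) (rule conn_spanning_iff_linked)
  ultimately show ?thesis
    by (simp only: j_def)
qed

lemma subset_sum_shift: "subset_sum (k + 1) E P = smult (-2) (subset_sum k E P)"
proof -
  have "(-2 :: real) powi (k + 1 + int n) = -2 * (-2) powi (k + int n)" for n
    by (simp add: power_int_add mult_ac)
  moreover have "smult r (sum g A) = (\<Sum>i\<in>A. smult r (g i))" for r :: real and g and A :: "'a set set"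
    by (induction A rule: infinite_finite_induct) (simp_all add: smult_add_right)
  ultimately show ?thesis
    by (simp add: subset_sum_def)
qed

text \<open>A set without \<open>e\<close> gains a factor \<open>1 + u\<close>, a set with
  \<open>e\<close> a factor \<open>-2\<close>, which is recorded by raising
  \<open>k\<close>.\<close>

lemma subset_sum_insert:
  assumes "finite E" "e \<notin> E"
  shows "subset_sum k (insert e E) P = [:1, 1:] * subset_sum k E P + subset_sum (k + 1) E (\<lambda>S. P (insert e S))"
proof -
  have fin: "finite S" if "S \<subseteq> E" for S
    using that assms finite_subset by blast
  let ?t = "\<lambda>S. smult ((-2) powi (k + int (card S))) ([:1, 1:] ^ (card (insert e E) - card S)) :: real poly"
  have split: "{S. S \<subseteq> insert e E \<and> P S} = {S. S \<subseteq> E \<and> P S} \<union> insert e ` {S. S \<subseteq> E \<and> P (insert e S)}"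
  proof (intro equalityI subsetI)
    fix S assume *: "S \<in> {S. S \<subseteq> insert e E \<and> P S}"
    show "S \<in> {S. S \<subseteq> E \<and> P S} \<union> insert e ` {S. S \<subseteq> E \<and> P (insert e S)}"
    proof (cases "e \<in> S")
      case True
      then have "S = insert e (S - {e})"
        by auto
      with * show ?thesis
        by (auto intro!: image_eqI[of _ _ "S - {e}"])
    next
      case False
      with * show ?thesis
        by auto
    qed
  next
    fix S assume "S \<in> {S. S \<subseteq> E \<and> P S} \<union> insert e ` {S. S \<subseteq> E \<and> P (insert e S)}"
    then show "S \<in> {S. S \<subseteq> insert e E \<and> P S}"
      by auto
  qed
  have "(\<Sum>S\<in>{S. S \<subseteq> insert e E \<and> P S}. ?t S)
      = (\<Sum>S\<in>{S. S \<subseteq> E \<and> P S}. ?t S) + (\<Sum>S\<in>insert e ` {S. S \<subseteq> E \<and> P (insert e S)}. ?t S)"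
    unfolding split using assms by (intro sum.union_disjoint) auto
  also have "(\<Sum>S\<in>{S. S \<subseteq> E \<and> P S}. ?t S) = [:1, 1:] * subset_sum k E P"
    unfolding subset_sum_def sum_distrib_left
  proof (intro sum.cong refl)
    fix S assume "S \<in> {S. S \<subseteq> E \<and> P S}"
    then have "card (insert e E) - card S = Suc (card E - card S)"
      using assms card_mono[of E S] by (simp add: Suc_diff_le)
    then show "?t S = [:1, 1:] * smult ((-2) powi (k + int (card S))) ([:1, 1:] ^ (card E - card S))"
      by (simp add: mult_smult_right del: mult_pCons_left)
  qed
  also have "(\<Sum>S\<in>insert e ` {S. S \<subseteq> E \<and> P (insert e S)}. ?t S) = (\<Sum>S\<in>{S. S \<subseteq> E \<and> P (insert e S)}. ?t (insert e S))"
    using assms by (intro sum.reindex[unfolded comp_def]) (auto simp: inj_on_def)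
  also have "\<dots> = subset_sum (k + 1) E (\<lambda>S. P (insert e S))"
    unfolding subset_sum_def
  proof (intro sum.cong refl)
    fix S assume "S \<in> {S. S \<subseteq> E \<and> P (insert e S)}"
    then have "card (insert e S) = Suc (card S)" "card (insert e E) = Suc (card E)"
      using assms fin by (auto simp: card_insert_if)
    then show "?t (insert e S) = smult ((-2) powi (k + 1 + int (card S))) ([:1, 1:] ^ (card E - card S))"
      by (simp add: algebra_simps)
  qed
  finally show ?thesis
    by (simp add: subset_sum_def)
qed

lemma subset_sum_union:
  assumes fin: "finite E1" "finite E2" and disj: "E1 \<inter> E2 = {}"
    and P: "\<And>S1 S2. S1 \<subseteq> E1 \<Longrightarrow> S2 \<subseteq> E2 \<Longrightarrow> P (S1 \<union> S2) \<longleftrightarrow> P1 S1 \<and> P2 S2"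
  shows "subset_sum (k1 + k2) (E1 \<union> E2) P = subset_sum k1 E1 P1 * subset_sum k2 E2 P2"
proof -
  let ?A = "{S. S \<subseteq> E1 \<and> P1 S}" and ?B = "{S. S \<subseteq> E2 \<and> P2 S}"
  let ?t = "\<lambda>k E S. smult ((-2) powi (k + int (card S))) ([:1, 1:] ^ (card E - card S)) :: real poly"
  have "subset_sum k1 E1 P1 * subset_sum k2 E2 P2 = (\<Sum>(S1, S2)\<in>?A \<times> ?B. ?t k1 E1 S1 * ?t k2 E2 S2)"
    by (simp add: subset_sum_def sum_product sum.cartesian_product)
  also have "\<dots> = subset_sum (k1 + k2) (E1 \<union> E2) P"
    unfolding subset_sum_def
  proof (rule sum.reindex_bij_witness[of _ "\<lambda>S. (S \<inter> E1, S \<inter> E2)" "\<lambda>(S1, S2). S1 \<union> S2"])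
    fix S assume S: "S \<in> {S. S \<subseteq> E1 \<union> E2 \<and> P S}"
    then have "S = (S \<inter> E1) \<union> (S \<inter> E2)"
      by auto
    then show "(case (S \<inter> E1, S \<inter> E2) of (S1, S2) \<Rightarrow> S1 \<union> S2) = S"
      by auto
    have "P1 (S \<inter> E1) \<and> P2 (S \<inter> E2)"
      using P[of "S \<inter> E1" "S \<inter> E2"] S \<open>S = (S \<inter> E1) \<union> (S \<inter> E2)\<close> by auto
    then show "(S \<inter> E1, S \<inter> E2) \<in> ?A \<times> ?B"
      by auto
  next
    fix p assume "p \<in> ?A \<times> ?B"
    then obtain S1 S2 where p: "p = (S1, S2)" and S: "S1 \<subseteq> E1" "S2 \<subseteq> E2" "P1 S1" "P2 S2"
      by auto
    show "(case p of (S1, S2) \<Rightarrow> S1 \<union> S2) \<in> {S. S \<subseteq> E1 \<union> E2 \<and> P S}"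
      using p S P[of S1 S2] by auto
    show "((case p of (S1, S2) \<Rightarrow> S1 \<union> S2) \<inter> E1, (case p of (S1, S2) \<Rightarrow> S1 \<union> S2) \<inter> E2) = p"
      using p S disj by auto
    have f: "finite S1" "finite S2" "S1 \<inter> S2 = {}"
      using S fin disj finite_subset by blast+
    have c: "card (S1 \<union> S2) = card S1 + card S2" "card (E1 \<union> E2) = card E1 + card E2"
      using f fin disj by (simp_all add: card_Un_disjoint)
    have le: "card S1 \<le> card E1" "card S2 \<le> card E2"
      using S fin by (simp_all add: card_mono)
    have e1: "k1 + k2 + int (card (S1 \<union> S2)) = (k1 + int (card S1)) + (k2 + int (card S2))"
      by (simp add: c)
    have e2: "card (E1 \<union> E2) - card (S1 \<union> S2) = (card E1 - card S1) + (card E2 - card S2)"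
      using le by (simp add: c)
    show "?t (k1 + k2) (E1 \<union> E2) (case p of (S1, S2) \<Rightarrow> S1 \<union> S2) = (case p of (S1, S2) \<Rightarrow> ?t k1 E1 S1 * ?t k2 E2 S2)"
      unfolding p prod.case e1 e2 power_add
      by (subst power_int_add) (simp_all add: mult_smult_left mult_smult_right mult_ac)
  qed
  finally show ?thesis ..
qed

lemma subset_sum_disj:
  assumes "finite E"
  shows "subset_sum k E (\<lambda>S. P S \<or> Q S) + subset_sum k E (\<lambda>S. P S \<and> Q S) = subset_sum k E P + subset_sum k E Q"
proof -
  let ?A = "{S. S \<subseteq> E \<and> P S}" and ?B = "{S. S \<subseteq> E \<and> Q S}"
  have "finite ?A" "finite ?B"
    using assms by auto
  moreover have "{S. S \<subseteq> E \<and> (P S \<or> Q S)} = ?A \<union> ?B" "{S. S \<subseteq> E \<and> P S \<and> Q S} = ?A \<inter> ?B"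
    by auto
  ultimately show ?thesis
    unfolding subset_sum_def by (simp only: sum.union_inter)
qed

section \<open>Gluing two networks\<close>


text \<open>Inclusion-exclusion over the two alternatives of \<open>linked_parallel\<close>.\<close>

lemma subset_sum_parallel:
  fixes f :: "'e \<Rightarrow> 'a \<times> 'a"
    and v a b :: 'a and k1 k2 :: int
  assumes fin: "finite E1" "finite E2" and disj: "E1 \<inter> E2 = {}"
    and v: "V1 \<inter> V2 = {v}" and a: "a \<in> V1" and b: "b \<in> V2"
    and E: "\<And>e. e \<in> E1 \<Longrightarrow> f e \<in> V1 \<times> V1" "\<And>e. e \<in> E2 \<Longrightarrow> f e \<in> V2 \<times> V2"
  defines "C1 \<equiv> subset_sum k1 E1 (linked V1 f {})" and "D1 \<equiv> subset_sum (k1 + 1) E1 (linked V1 f {(v, a)})"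
    and "C2 \<equiv> subset_sum k2 E2 (linked V2 f {})" and "D2 \<equiv> subset_sum (k2 + 1) E2 (linked V2 f {(v, b)})"
  shows "subset_sum (k1 + k2 + 1) (E1 \<union> E2) (linked (V1 \<union> V2) f {(a, b)}) = C1 * D2 + D1 * C2 + smult 2 (C1 * C2)"
proof -
  define P where "P S \<longleftrightarrow> linked V1 f {} (S \<inter> E1) \<and> linked V2 f {(v, b)} (S \<inter> E2)" for S
  define Q where "Q S \<longleftrightarrow> linked V1 f {(v, a)} (S \<inter> E1) \<and> linked V2 f {} (S \<inter> E2)" for S
  have Int: "(S1 \<union> S2) \<inter> E1 = S1" "(S1 \<union> S2) \<inter> E2 = S2" if "S1 \<subseteq> E1" "S2 \<subseteq> E2" for S1 S2
    using that disj by blast+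
  have "subset_sum (k1 + k2 + 1) (E1 \<union> E2) (linked (V1 \<union> V2) f {(a, b)})
      = subset_sum (k1 + k2 + 1) (E1 \<union> E2) (\<lambda>S. P S \<or> Q S)"
  proof (rule subset_sum_cong[OF refl refl])
    fix S assume "S \<subseteq> E1 \<union> E2"
    then have S: "S = (S \<inter> E1) \<union> (S \<inter> E2)"
      by blast
    have "linked (V1 \<union> V2) f {(a, b)} ((S \<inter> E1) \<union> (S \<inter> E2)) \<longleftrightarrow> P S \<or> Q S"
      unfolding P_def Q_def by (rule linked_parallel[OF v a b]) (use E in blast)+
    then show "linked (V1 \<union> V2) f {(a, b)} S \<longleftrightarrow> P S \<or> Q S"
      by (simp only: S[symmetric])
  qed
  moreover have "subset_sum (k1 + k2 + 1) (E1 \<union> E2) P = C1 * D2"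
    unfolding C1_def D2_def add.assoc by (rule subset_sum_union[OF fin disj]) (simp only: P_def Int)
  moreover have "subset_sum (k1 + 1 + k2) (E1 \<union> E2) Q = D1 * C2"
    unfolding C2_def D1_def by (rule subset_sum_union[OF fin disj]) (simp only: Q_def Int)
  then have "subset_sum (k1 + k2 + 1) (E1 \<union> E2) Q = D1 * C2"
    by (simp only: add_ac)
  moreover have "subset_sum (k1 + k2) (E1 \<union> E2) (\<lambda>S. P S \<and> Q S) = C1 * C2"
    unfolding C1_def C2_def
  proof (rule subset_sum_union[OF fin disj])
    fix S1 S2 assume "S1 \<subseteq> E1" "S2 \<subseteq> E2"
    then show "P (S1 \<union> S2) \<and> Q (S1 \<union> S2) \<longleftrightarrow> linked V1 f {} S1 \<and> linked V2 f {} S2"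
      using linked_mono[of "{}" "{(v, a)}" V1 f S1] linked_mono[of "{}" "{(v, b)}" V2 f S2]
      by (simp only: P_def Q_def Int) blast
  qed
  \<comment> \<open>The overlap factorizes with shift \<open>k1 + k2\<close>, one below the
    left-hand side; the difference costs a factor \<open>-2\<close>, which becomes \<open>+2\<close>
    when the overlap is subtracted.\<close>
  then have "subset_sum (k1 + k2 + 1) (E1 \<union> E2) (\<lambda>S. P S \<and> Q S) = smult (-2) (C1 * C2)"
    by (simp only: subset_sum_shift)
  moreover have "subset_sum (k1 + k2 + 1) (E1 \<union> E2) (\<lambda>S. P S \<or> Q S) + subset_sum (k1 + k2 + 1) (E1 \<union> E2) (\<lambda>S. P S \<and> Q S)
      = subset_sum (k1 + k2 + 1) (E1 \<union> E2) P + subset_sum (k1 + k2 + 1) (E1 \<union> E2) Q"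
    using fin by (intro subset_sum_disj) simp
  ultimately have "subset_sum (k1 + k2 + 1) (E1 \<union> E2) (linked (V1 \<union> V2) f {(a, b)}) + smult (-2) (C1 * C2)
      = C1 * D2 + D1 * C2"
    by (simp only:)
  moreover have "smult (-2) p + smult 2 p = 0" for p :: "real poly"
    by (simp flip: smult_add_left)
  ultimately show ?thesis
    by (metis add.assoc add.right_neutral)
qed

text \<open>With \<open>\<epsilon>\<^sup>2 = 1\<close>, an edge joining \<open>a\<close> and \<open>b\<close> multiplies \<open>K + \<epsilon> J\<close> by \<open>u + \<epsilon>\<close>.\<close>
lemma hsquare_add_edges:
  fixes f :: "'e \<Rightarrow> 'a \<times> 'a"
  assumes fin: "finite E" "finite F" and F: "\<And>e. e \<in> F \<Longrightarrow> f e = (a, b) \<or> f e = (b, a)" and disj: "E \<inter> F = {}"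
    and sq: "hsquare (subset_sum k E (linked V f {}) + subset_sum (k + 1) E (linked V f {(a, b)}))
      (subset_sum k E (linked V f {}))"
  shows "hsquare (subset_sum k (E \<union> F) (linked V f {}) + subset_sum (k + 1) (E \<union> F) (linked V f {(a, b)}))
      (subset_sum k (E \<union> F) (linked V f {}))"
  using fin(2) F disj
proof (induction F)
  case empty
  then show ?case
    using sq by simp
next
  case (insert e F)
  let ?E = "E \<union> F"
  let ?m = "subset_sum k ?E (linked V f {})" and ?b = "subset_sum (k + 1) ?E (linked V f {(a, b)})"
  have fe: "f e = (a, b) \<or> f e = (b, a)" and e: "e \<notin> ?E" and finE: "finite ?E"
    using insert fin by auto
  have "hsquare (?m + ?b) ?m"
    using insert by auto
  from hsquare_mult(1)[OF hsquare_edge this]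
  have *: "hsquare ([:0, 1:] * (?m + ?b) + 1 * ?m) ([:0, 1:] * ?m + 1 * (?m + ?b))" .
  note ins = linked_insert_edge[where f = f and e = e and a = a and b = b, OF fe]
  have y: "[:1, 1:] * p = [:0, 1:] * p + p" for p :: "real poly"
    by simp
  have m: "subset_sum k (insert e ?E) (linked V f {}) = [:0, 1:] * ?m + 1 * (?m + ?b)"
    unfolding subset_sum_insert[OF finE e] ins y by (simp only: mult_1_left add_ac)
  \<comment> \<open>Once \<open>a\<close> and \<open>b\<close> are identified, \<open>e\<close> is a
    loop and does not affect connectedness; its factor is
    \<open>(1 + u) - 2 = u - 1\<close>.\<close>
  have b: "subset_sum (k + 1) (insert e ?E) (linked V f {(a, b)}) = [:0, 1:] * ?b + ?b + smult (-2) ?b"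
    unfolding subset_sum_insert[OF finE e] ins y insert_absorb2 subset_sum_shift[of "k + 1"] ..
  have "smult (-2) p = - p - p" for p :: "real poly"
    using smult_add_left[of "-1" "-1" p] by simp
  then have "[:0, 1:] * ?m + 1 * (?m + ?b) + ([:0, 1:] * ?b + ?b + smult (-2) ?b) = [:0, 1:] * (?m + ?b) + 1 * ?m"
    by (simp only: distrib_left mult_1_left)
  with * show ?case
    by (simp only: m b Un_insert_right)
qed

text \<open>The loops created by the identification are the edges deleted in the other construction,
  so both polynomials are sums over the same edge set.\<close>

lemma edges_identify:
  assumes "wf_mgraph G" "a \<noteq> b"
  shows "edges (identify G a b) = edges (del_between G a b)"
proof -
  have *: "(if fst p = b then a else fst p) \<noteq> (if snd p = b then a else snd p) \<longleftrightarrow> p \<noteq> (a, b) \<and> p \<noteq> (b, a)"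
    if "fst p \<noteq> snd p" for p
    using that assms(2) by (cases p) auto
  have **: "fst (ends G e) \<noteq> snd (ends G e)" if "e \<in> edges G" for e
    using assms(1) that by (simp add: wf_mgraph_def)
  have "edges (identify G a b) = {e \<in> edges G.
      (if fst (ends G e) = b then a else fst (ends G e)) \<noteq> (if snd (ends G e) = b then a else snd (ends G e))}"
    by (simp add: identify_def Let_def)
  also have "\<dots> = {e \<in> edges G. ends G e \<noteq> (a, b) \<and> ends G e \<noteq> (b, a)}"
    by (intro Collect_cong conj_cong refl *[OF **])
  also have "\<dots> = edges (del_between G a b)"
    by (simp add: del_between_def)
  finally show ?thesis .
qed

lemma wf_identify: "wf_mgraph G \<Longrightarrow> wf_mgraph (identify G a b)"
  unfolding wf_mgraph_def identify_def Let_def by (auto simp: map_prod_def split_beta)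

lemma card_verts_identify:
  assumes "finite (verts G)" "a \<in> verts G" "b \<in> verts G" "a \<noteq> b"
  shows "int (card (verts (identify G a b))) = int (card (verts G)) - 1"
proof -
  have "verts (identify G a b) = verts G - {b}"
    using assms by (auto simp: identify_def Let_def)
  moreover have "card (verts G) > 0"
    using assms by (auto simp: card_gt_0_iff)
  ultimately show ?thesis
    using assms by (simp add: of_nat_diff)
qed

lemma linked_verts_identify:
  assumes "\<And>p q. (p, q) \<in> R \<Longrightarrow> p \<noteq> b \<and> q \<noteq> b"
  shows "linked (verts (identify G a b)) (ends (identify G a b)) R S \<longleftrightarrow> linked (verts G) (ends G) (insert (a, b) R) S"
  using linked_identify[OF assms] by (simp add: identify_def Let_def)

lemma J_poly_del_between:
  assumes "wf_mgraph G"
  shows "J_poly (del_between G a b)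
    = subset_sum (1 - int (card (verts G))) (edges (del_between G a b)) (linked (verts G) (ends G) {})"
  using assms J_poly_eq[of "del_between G a b"] by (simp add: wf_mgraph_def del_between_def)

lemma J_poly_identify:
  assumes "wf_mgraph G" "a \<in> verts G" "b \<in> verts G" "a \<noteq> b"
  shows "J_poly (identify G a b)
    = subset_sum (1 - int (card (verts G)) + 1) (edges (del_between G a b)) (linked (verts G) (ends G) {(a, b)})"
proof -
  have "finite (verts (identify G a b))" "finite (edges (identify G a b))"
    using wf_identify[OF assms(1)] by (auto simp: wf_mgraph_def)
  then have "J_poly (identify G a b) = subset_sum (1 - int (card (verts (identify G a b)))) (edges (identify G a b))
      (linked (verts (identify G a b)) (ends (identify G a b)) {})"
    by (rule J_poly_eq)
  also have "\<dots> = subset_sum (1 - int (card (verts G)) + 1) (edges (del_between G a b)) (linked (verts G) (ends G) {(a, b)})"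
  proof (rule subset_sum_cong)
    show "1 - int (card (verts (identify G a b))) = 1 - int (card (verts G)) + 1"
      using assms card_verts_identify[of G a b] by (simp add: wf_mgraph_def)
    show "edges (identify G a b) = edges (del_between G a b)"
      by (rule edges_identify[OF assms(1,4)])
    show "linked (verts (identify G a b)) (ends (identify G a b)) {} S \<longleftrightarrow> linked (verts G) (ends G) {(a, b)} S" for S
      by (rule linked_verts_identify) simp
  qed
  finally show ?thesis .
qed

text \<open>The edge set and the shift enter as \<open>M\<close> and \<open>k\<close> because for
  \<open>U\<close> and \<open>W\<close> they are known in split form.\<close>

lemma amicable_iff:
  assumes "wf_mgraph G" "a \<in> verts G" "b \<in> verts G" "a \<noteq> b"
    and "edges (del_between G a b) = M" "1 - int (card (verts G)) = k"
  shows "amicable G a b \<longleftrightarrow>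
      hsquare (subset_sum k M (linked (verts G) (ends G) {}) + subset_sum (k + 1) M (linked (verts G) (ends G) {(a, b)}))
        (subset_sum k M (linked (verts G) (ends G) {}))"
    and "very_amicable G a b \<longleftrightarrow>
      hsquare (subset_sum (k + 1) M (linked (verts G) (ends G) {(a, b)})) (subset_sum k M (linked (verts G) (ends G) {}))"
  using assms(2-4)
  by (simp_all add: amicable_def very_amicable_def hsquare_def Let_def J0_def J1_def
      J_poly_del_between[OF assms(1)] J_poly_identify[OF assms(1-4)] flip: assms(5,6))

theorem theorem5p2:
  fixes G N :: "('a, 'e) mgraph" and v w' w'' :: 'a
  assumes "network G" and "network N"
    and "verts G \<inter> verts N = {v}"
    and "edges G \<inter> edges N = {}"
    and "w' \<in> verts G" and "w' \<noteq> v"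
    and "w'' \<in> verts N" and "w'' \<noteq> v"
    and "amicable G v w'" and "amicable N v w''"
  shows "amicable (mg_union G N) v w' \<and> amicable (mg_union G N) v w''
       \<and> amicable (identify (mg_union G N) w' w'') v w'
       \<and> very_amicable (mg_union G N) w' w''"
proof -
  let ?U = "mg_union G N"
  let ?W = "identify ?U w' w''"
  let ?V1 = "verts G" and ?V2 = "verts N" and ?E1 = "edges G" and ?E2 = "edges N" and ?f = "ends ?U"
  let ?M1 = "edges (del_between G v w')" and ?M2 = "edges (del_between N v w'')"
  define k1 where "k1 = 1 - int (card ?V1)"
  define k2 where "k2 = 1 - int (card ?V2)"
  note v = assms(3)
  have vV: "v \<in> ?V1" "v \<in> ?V2"
    using v by auto
  have w: "w' \<notin> ?V2" "w'' \<notin> ?V1" "w' \<noteq> w''"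
    using assms(3,5-8) by auto
  have wf: "wf_mgraph G" "wf_mgraph N"
    using assms(1,2) by (auto simp: network_def)
  have fin: "finite ?V1" "finite ?V2" "finite ?E1" "finite ?E2"
    using wf by (auto simp: wf_mgraph_def)
  have U: "verts ?U = ?V1 \<union> ?V2" "edges ?U = ?E1 \<union> ?E2"
    by (simp_all add: mg_union_def)
  have f1: "?f e = ends G e" if "e \<in> ?E1" for e
    using that by (simp add: mg_union_def)
  have f2: "?f e = ends N e" if "e \<in> ?E2" for e
    using that assms(4) by (auto simp: mg_union_def)
  have E1: "?f e \<in> ?V1 \<times> ?V1" if "e \<in> ?E1" for e
    using wf(1) that by (simp add: f1 wf_mgraph_def mem_Times_iff)
  have E2: "?f e \<in> ?V2 \<times> ?V2" if "e \<in> ?E2" for e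
    using wf(2) that by (simp add: f2 wf_mgraph_def mem_Times_iff)
  have wfU: "wf_mgraph ?U"
    unfolding wf_mgraph_def U
  proof (intro conjI ballI)
    fix e assume "e \<in> ?E1 \<union> ?E2"
    then show "fst (?f e) \<in> ?V1 \<union> ?V2" "snd (?f e) \<in> ?V1 \<union> ?V2"
      using E1[of e] E2[of e] by (auto simp: mem_Times_iff)
    show "fst (?f e) \<noteq> snd (?f e)"
      using \<open>e \<in> ?E1 \<union> ?E2\<close> wf f1[of e] f2[of e] by (auto simp: wf_mgraph_def)
  qed (use fin in auto)
  have M: "?M1 \<subseteq> ?E1" "?M2 \<subseteq> ?E2"
    by (auto simp: del_between_def)
  have finM: "finite ?M1" "finite ?M2"
    using M fin finite_subset by blast+
  have cardU: "1 - int (card (verts ?U)) = k1 + k2"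
  proof -
    have "card (?V1 \<union> ?V2) + card (?V1 \<inter> ?V2) = card ?V1 + card ?V2"
      using card_Un_Int[OF fin(1,2)] by simp
    then show ?thesis
      by (simp add: U v k1_def k2_def)
  qed
  have cardW: "1 - int (card (verts ?W)) = k1 + k2 + 1"
    using card_verts_identify[of ?U w' w''] cardU fin assms(5,7) w by (simp add: U)

  \<comment> \<open>Functions of the edge set: the hypotheses concern \<open>?M1\<close> and
    \<open>?M2\<close>, but the edges between \<open>v\<close> and \<open>w'\<close> or
    \<open>w''\<close> survive where another pair of \<open>?U\<close> is tested.\<close>
  define C1 where "C1 E = subset_sum k1 E (linked ?V1 ?f {})" for E
  define D1 where "D1 E = subset_sum (k1 + 1) E (linked ?V1 ?f {(v, w')})" for E
  define C2 where "C2 E = subset_sum k2 E (linked ?V2 ?f {})" for E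
  define D2 where "D2 E = subset_sum (k2 + 1) E (linked ?V2 ?f {(v, w'')})" for E
  have sqM1: "hsquare (C1 ?M1 + D1 ?M1) (C1 ?M1)"
  proof -
    have "linked ?V1 ?f R S \<longleftrightarrow> linked ?V1 (ends G) R S" if "S \<subseteq> ?M1" for R S
      using that M f1 by (intro linked_cong) blast
    then have "subset_sum k ?M1 (linked ?V1 ?f R) = subset_sum k ?M1 (linked ?V1 (ends G) R)" for k R
      by (intro subset_sum_cong refl)
    then show ?thesis
      using amicable_iff(1)[OF wf(1) vV(1) assms(5) assms(6)[symmetric] refl k1_def[symmetric]] assms(9)
      by (simp only: C1_def D1_def)
  qed
  have sqM2: "hsquare (C2 ?M2 + D2 ?M2) (C2 ?M2)"
  proof -
    have "linked ?V2 ?f R S \<longleftrightarrow> linked ?V2 (ends N) R S" if "S \<subseteq> ?M2" for R S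
      using that M f2 by (intro linked_cong) blast
    then have "subset_sum k ?M2 (linked ?V2 ?f R) = subset_sum k ?M2 (linked ?V2 (ends N) R)" for k R
      by (intro subset_sum_cong refl)
    then show ?thesis
      using amicable_iff(1)[OF wf(2) vV(2) assms(7) assms(8)[symmetric] refl k2_def[symmetric]] assms(10)
      by (simp only: C2_def D2_def)
  qed
  have sqE1: "hsquare (C1 ?E1 + D1 ?E1) (C1 ?E1)"
  proof -
    have "hsquare (C1 (?M1 \<union> (?E1 - ?M1)) + D1 (?M1 \<union> (?E1 - ?M1))) (C1 (?M1 \<union> (?E1 - ?M1)))"
      unfolding C1_def D1_def
    proof (rule hsquare_add_edges)
      show "?f e = (v, w') \<or> ?f e = (w', v)" if "e \<in> ?E1 - ?M1" for e
        using that f1[of e] by (auto simp: del_between_def)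
    qed (use finM fin sqM1 in \<open>auto simp: C1_def D1_def\<close>)
    moreover have "?M1 \<union> (?E1 - ?M1) = ?E1"
      using M by blast
    ultimately show ?thesis
      by simp
  qed
  have sqE2: "hsquare (C2 ?E2 + D2 ?E2) (C2 ?E2)"
  proof -
    have "hsquare (C2 (?M2 \<union> (?E2 - ?M2)) + D2 (?M2 \<union> (?E2 - ?M2))) (C2 (?M2 \<union> (?E2 - ?M2)))"
      unfolding C2_def D2_def
    proof (rule hsquare_add_edges)
      show "?f e = (v, w'') \<or> ?f e = (w'', v)" if "e \<in> ?E2 - ?M2" for e
        using that f2[of e] by (auto simp: del_between_def)
    qed (use finM fin sqM2 in \<open>auto simp: C2_def D2_def\<close>)
    moreover have "?M2 \<union> (?E2 - ?M2) = ?E2"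
      using M by blast
    ultimately show ?thesis
      by simp
  qed

  have cut: "subset_sum (l1 + l2) (X \<union> Y) (linked (verts ?U) ?f R)
      = subset_sum l1 X (linked ?V1 ?f R1) * subset_sum l2 Y (linked ?V2 ?f R2)"
    if XY: "X \<subseteq> ?E1" "Y \<subseteq> ?E2" and R: "R1 \<subseteq> ?V1 \<times> ?V1" "R2 \<subseteq> ?V2 \<times> ?V2"
      "\<And>S. linked (verts ?U) ?f R S \<longleftrightarrow> linked (?V1 \<union> ?V2) ?f (R1 \<union> R2) S" for X Y R R1 R2 l1 l2
  proof (rule subset_sum_union)
    show "finite X" "finite Y"
      using XY fin finite_subset by blast+
    show "X \<inter> Y = {}"
      using XY assms(4) by blast
    fix S1 S2 assume "S1 \<subseteq> X" "S2 \<subseteq> Y"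
    then show "linked (verts ?U) ?f R (S1 \<union> S2) \<longleftrightarrow> linked ?V1 ?f R1 S1 \<and> linked ?V2 ?f R2 S2"
      unfolding R(3) using XY E1 E2 by (intro linked_cut_vertex[OF v] R) blast+
  qed
  have parallel: "subset_sum (k1 + k2 + 1) (X \<union> Y) (linked (verts ?U) ?f {(w', w'')})
      = (C1 X + D1 X) * C2 Y + C1 X * (C2 Y + D2 Y)"
    if XY: "X \<subseteq> ?E1" "Y \<subseteq> ?E2" for X Y
  proof -
    have "subset_sum (k1 + k2 + 1) (X \<union> Y) (linked (?V1 \<union> ?V2) ?f {(w', w'')})
        = C1 X * D2 Y + D1 X * C2 Y + smult 2 (C1 X * C2 Y)"
      unfolding C1_def D1_def C2_def D2_def
    proof (rule subset_sum_parallel)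
      show "finite X" "finite Y"
        using XY fin finite_subset by blast+
      show "X \<inter> Y = {}"
        using XY assms(4) by blast
    qed (use XY E1 E2 v assms(5,7) in blast)+
    \<comment> \<open>Splitting \<open>2 C1 C2\<close> evenly between the two mixed terms completes
      each \<open>D\<close> to \<open>C + D\<close>.\<close>
    moreover have "smult 2 p = p + p" for p :: "real poly"
      using smult_add_left[of 1 1 p] by simp
    ultimately show ?thesis
      by (simp add: U algebra_simps)
  qed

  have "amicable ?U v w'"
  proof -
    have "edges (del_between ?U v w') = ?M1 \<union> ?E2"
      using f1 f2 E2 w by (fastforce simp: del_between_def U)
    then have "amicable ?U v w' \<longleftrightarrow> hsquare (subset_sum (k1 + k2) (?M1 \<union> ?E2) (linked (verts ?U) ?f {})
          + subset_sum (k1 + k2 + 1) (?M1 \<union> ?E2) (linked (verts ?U) ?f {(v, w')}))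
        (subset_sum (k1 + k2) (?M1 \<union> ?E2) (linked (verts ?U) ?f {}))"
      using vV assms(5,6) by (intro amicable_iff(1) wfU cardU) (auto simp: U)
    moreover have "subset_sum (k1 + k2) (?M1 \<union> ?E2) (linked (verts ?U) ?f {}) = C1 ?M1 * C2 ?E2"
      unfolding C1_def C2_def using M by (intro cut) (auto simp: U)
    moreover have "subset_sum ((k1 + 1) + k2) (?M1 \<union> ?E2) (linked (verts ?U) ?f {(v, w')}) = D1 ?M1 * C2 ?E2"
      unfolding D1_def C2_def using M vV assms(5) by (intro cut) (auto simp: U)
    \<comment> \<open>\<open>C2 ?E2\<close> is the polynomial of \<open>N\<close>; it is Hurwitz as
      the second entry of a square.\<close>
    moreover have "hsquare ((C1 ?M1 + D1 ?M1) * C2 ?E2 + C1 ?M1 * 0) ((C1 ?M1 + D1 ?M1) * 0 + C1 ?M1 * C2 ?E2)"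
      by (intro hsquare_mult(1) sqM1 hsquare_hurwitz_0 hsquare_imp(2)[OF sqE2])
    ultimately show ?thesis
      by (simp add: algebra_simps)
  qed
  moreover have "amicable ?U v w''"
  proof -
    have "edges (del_between ?U v w'') = ?E1 \<union> ?M2"
      using f1 f2 E1 w by (fastforce simp: del_between_def U)
    then have "amicable ?U v w'' \<longleftrightarrow> hsquare (subset_sum (k1 + k2) (?E1 \<union> ?M2) (linked (verts ?U) ?f {})
          + subset_sum (k1 + k2 + 1) (?E1 \<union> ?M2) (linked (verts ?U) ?f {(v, w'')}))
        (subset_sum (k1 + k2) (?E1 \<union> ?M2) (linked (verts ?U) ?f {}))"
      using vV assms(7,8) by (intro amicable_iff(1) wfU cardU) (auto simp: U)
    moreover have "subset_sum (k1 + k2) (?E1 \<union> ?M2) (linked (verts ?U) ?f {}) = C1 ?E1 * C2 ?M2"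
      unfolding C1_def C2_def using M by (intro cut) (auto simp: U)
    moreover have "subset_sum (k1 + (k2 + 1)) (?E1 \<union> ?M2) (linked (verts ?U) ?f {(v, w'')}) = C1 ?E1 * D2 ?M2"
      unfolding D2_def C1_def using M vV assms(7) by (intro cut) (auto simp: U)
    moreover have "hsquare ((C2 ?M2 + D2 ?M2) * C1 ?E1 + C2 ?M2 * 0) ((C2 ?M2 + D2 ?M2) * 0 + C2 ?M2 * C1 ?E1)"
      by (intro hsquare_mult(1) sqM2 hsquare_hurwitz_0 hsquare_imp(2)[OF sqE1])
    ultimately show ?thesis
      by (simp add: algebra_simps)
  qed
  moreover have edgesU: "edges (del_between ?U w' w'') = ?E1 \<union> ?E2"
    using E1 E2 w by (fastforce simp: del_between_def U)
  moreover have "amicable ?W v w'"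
  proof -
    have endsW: "ends ?W e = map_prod (\<lambda>x. if x = w'' then w' else x) (\<lambda>x. if x = w'' then w' else x) (?f e)" for e
      by (simp add: identify_def Let_def)
    have "edges ?W = ?E1 \<union> ?E2"
      using edges_identify[OF wfU w(3)] edgesU by simp
    moreover have "ends ?W e = (v, w') \<longleftrightarrow> ends G e = (v, w')" "ends ?W e = (w', v) \<longleftrightarrow> ends G e = (w', v)" if "e \<in> ?E1" for e
      using E1[OF that] w f1[OF that] by (cases "ends G e"; auto simp: endsW split: if_splits)+
    \<comment> \<open>The merged vertex keeps the name \<open>w'\<close>, so an edge of
      \<open>N\<close> between \<open>v\<close> and \<open>w''\<close> becomes one between
      \<open>v\<close> and \<open>w'\<close>.\<close>
    moreover have "ends ?W e = (v, w') \<longleftrightarrow> ends N e = (v, w'')" "ends ?W e = (w', v) \<longleftrightarrow> ends N e = (w'', v)" if "e \<in> ?E2" for e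
      using E2[OF that] w f2[OF that] assms(6,8) by (cases "ends N e"; auto simp: endsW split: if_splits)+
    ultimately have "edges (del_between ?W v w') = ?M1 \<union> ?M2"
      by (auto simp: del_between_def)
    then have "amicable ?W v w' \<longleftrightarrow> hsquare (subset_sum (k1 + k2 + 1) (?M1 \<union> ?M2) (linked (verts ?W) (ends ?W) {})
          + subset_sum (k1 + k2 + 1 + 1) (?M1 \<union> ?M2) (linked (verts ?W) (ends ?W) {(v, w')}))
        (subset_sum (k1 + k2 + 1) (?M1 \<union> ?M2) (linked (verts ?W) (ends ?W) {}))"
      using vV assms(5,6) w by (intro amicable_iff(1) wf_identify wfU cardW) (auto simp: identify_def Let_def U)
    moreover have "linked (verts ?W) (ends ?W) {} = linked (verts ?U) ?f {(w', w'')}"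
      by (rule ext, rule linked_verts_identify) simp
    moreover have "linked (verts ?W) (ends ?W) {(v, w')} = linked (verts ?U) ?f {(w', w''), (v, w')}"
      by (rule ext, rule linked_verts_identify) (use assms(8) w in auto)
    moreover have "subset_sum ((k1 + 1) + (k2 + 1)) (?M1 \<union> ?M2) (linked (verts ?U) ?f {(w', w''), (v, w')})
        = D1 ?M1 * D2 ?M2"
      unfolding D1_def D2_def
    proof (rule cut)
      \<comment> \<open>Identifying \<open>w''\<close> with \<open>w'\<close> and \<open>w'\<close>
        with \<open>v\<close> is the same as identifying each with \<open>v\<close>, and in this
        form the sum splits at the cut vertex.\<close>
      have "c w' = c w'' \<and> c v = c w' \<longleftrightarrow> c v = c w'' \<and> c v = c w'" for c :: "'a \<Rightarrow> bool"
        by auto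
      then show "linked (verts ?U) ?f {(w', w''), (v, w')} S \<longleftrightarrow> linked (?V1 \<union> ?V2) ?f ({(v, w')} \<union> {(v, w'')}) S" for S
        by (simp add: linked_def U)
    qed (use M vV assms(5,7) in auto)
    moreover note parallel[OF M]
    \<comment> \<open>With \<open>K = C + D\<close> and \<open>J = C\<close> on each side,
      \<open>D = K - J\<close> gives \<open>(K J' + J K') + D D' = K K' + J J'\<close>, the required
      first entry.\<close>
    moreover have "hsquare ((C1 ?M1 + D1 ?M1) * (C2 ?M2 + D2 ?M2) + C1 ?M1 * C2 ?M2)
        ((C1 ?M1 + D1 ?M1) * C2 ?M2 + C1 ?M1 * (C2 ?M2 + D2 ?M2))"
      by (intro hsquare_mult(1) sqM1 sqM2)
    ultimately show ?thesis
      by (simp add: algebra_simps)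
  qed
  moreover have "very_amicable ?U w' w''"
  proof -
    have "very_amicable ?U w' w'' \<longleftrightarrow> hsquare (subset_sum (k1 + k2 + 1) (?E1 \<union> ?E2) (linked (verts ?U) ?f {(w', w'')}))
        (subset_sum (k1 + k2) (?E1 \<union> ?E2) (linked (verts ?U) ?f {}))"
      using assms(5,7) w by (intro amicable_iff(2) wfU cardU edgesU) (auto simp: U)
    moreover have "subset_sum (k1 + k2) (?E1 \<union> ?E2) (linked (verts ?U) ?f {}) = C1 ?E1 * C2 ?E2"
      unfolding C1_def C2_def by (intro cut) (auto simp: U)
    moreover note parallel[OF subset_refl subset_refl]
    moreover have "hsquare ((C1 ?E1 + D1 ?E1) * C2 ?E2 + C1 ?E1 * (C2 ?E2 + D2 ?E2)) (C1 ?E1 * C2 ?E2)"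
      by (intro hsquare_mult(2) sqE1 sqE2)
    ultimately show ?thesis
      by simp
  qed
  ultimately show ?thesis
    by blast
qed

end
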